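(* Let $\mathcal{G}\subseteq\mathcal{M}_n(\mathbb{C})$ be an irreducible compact group of matrices in which all ring commutators $AB-BA$ ($A,B\in\mathcal{G}$) have real spectra. Then, up to simultaneous similarity, $\mathcal{G}$ is a signed permutation group with commutative pattern; that is, there is an invertible $X\in\mathcal{M}_n(\mathbb{C})$ such that $X^{-1}\mathcal{G}X$ is a signed permutation group whose pattern group is commutative. In particular, $\mathcal{G}$ is realizable.
   Context: $\mathcal{M}_n(\mathbb{C})$ is the algebra of $n\times n$ complex matrices. A group of matrices means a group of invertible matrices under multiplication (with identity $I$); compact is with respect to the usual topology. Irreducible means having no common invariant subspace of $\mathbb{C}^n$ other than $\{0\}$ and $\mathbb{C}^n$. Real spectrum means all eigenvalues are real. A signed permutation is a matrix with exactly one nonzero entry in each row and each column, all of whose nonzero entries lie in $\{1,-1\}$; a signed permutation group is a matrix group consisting of signed permutations. The pattern of such a matrix is the permutation matrix obtained by replacing each nonzero entry by $1$; the pattern group of a signed permutation group is the set of patterns of its members, and the group has commutative pattern if its pattern group is commutative. A group of matrices is realizable if it is simultaneously similar to a group of matrices with real entries.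
   Formalization: The formal theorem assumes n ≥ 2, because for n = 1 the claim fails: {1, i, -1, -i} is a compact irreducible group with all ring commutators 0, but it is similar neither to a group of signed permutations nor to a group of real matrices. *)

theory Defs
  imports "HOL-Analysis.Analysis"
begin

definition matrix_group :: "('a::field ^ 'n ^ 'n) set \<Rightarrow> bool" where
  "matrix_group G \<longleftrightarrow>
     (\<forall>A\<in>G. invertible A) \<and> mat 1 \<in> G \<and>
     (\<forall>A\<in>G. \<forall>B\<in>G. A ** B \<in> G) \<and> (\<forall>A\<in>G. matrix_inv A \<in> G)"

text \<open>Here \<^const>\<open>vec.subspace\<close> is linear over the base field \<open>'a\<close> (so complex-linear
  for \<open>'a = complex\<close>), unlike \<^const>\<open>subspace\<close>, which is real-linear.\<close>

definition irreducible_matrices :: "('a::field ^ 'n ^ 'n) set \<Rightarrow> bool" where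
  "irreducible_matrices G \<longleftrightarrow>
     (\<forall>W. vec.subspace W \<and> (\<forall>A\<in>G. \<forall>v\<in>W. A *v v \<in> W) \<longrightarrow> W = {0} \<or> W = UNIV)"

definition spectrum :: "'a::field ^ 'n ^ 'n \<Rightarrow> 'a set" where
  "spectrum A = {c. \<exists>v. v \<noteq> 0 \<and> A *v v = c *s v}"

definition ring_commutator :: "'a::field ^ 'n ^ 'n \<Rightarrow> 'a ^ 'n ^ 'n \<Rightarrow> 'a ^ 'n ^ 'n" where
  "ring_commutator A B = A ** B - B ** A"

definition conjugate_by :: "'a::field ^ 'n ^ 'n \<Rightarrow> ('a ^ 'n ^ 'n) set \<Rightarrow> ('a ^ 'n ^ 'n) set" where
  "conjugate_by X G = (\<lambda>A. matrix_inv X ** A ** X) ` G"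

definition signed_permutation :: "'a::field ^ 'n ^ 'n \<Rightarrow> bool" where
  "signed_permutation A \<longleftrightarrow>
     (\<forall>i. \<exists>!j. A $ i $ j \<noteq> 0) \<and> (\<forall>j. \<exists>!i. A $ i $ j \<noteq> 0) \<and>
     (\<forall>i j. A $ i $ j \<noteq> 0 \<longrightarrow> A $ i $ j \<in> {1, -1})"

definition signed_permutation_group :: "('a::field ^ 'n ^ 'n) set \<Rightarrow> bool" where
  "signed_permutation_group G \<longleftrightarrow> matrix_group G \<and> (\<forall>A\<in>G. signed_permutation A)"

definition pattern :: "'a::field ^ 'n ^ 'n \<Rightarrow> 'a ^ 'n ^ 'n" where
  "pattern A = (\<chi> i j. if A $ i $ j = 0 then 0 else 1)"

definition pattern_group :: "('a::field ^ 'n ^ 'n) set \<Rightarrow> ('a ^ 'n ^ 'n) set" where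
  "pattern_group G = pattern ` G"

definition commutative_pattern :: "('a::field ^ 'n ^ 'n) set \<Rightarrow> bool" where
  "commutative_pattern G \<longleftrightarrow>
     (\<forall>P\<in>pattern_group G. \<forall>Q\<in>pattern_group G. P ** Q = Q ** P)"

definition real_entries :: "complex ^ 'n ^ 'n \<Rightarrow> bool" where
  "real_entries A \<longleftrightarrow> (\<forall>i j. A $ i $ j \<in> \<real>)"

definition realizable :: "(complex ^ 'n ^ 'n) set \<Rightarrow> bool" where
  "realizable G \<longleftrightarrow>
     (\<exists>X. invertible X \<and> matrix_group (conjugate_by X G) \<and>
          (\<forall>A\<in>conjugate_by X G. real_entries A))"

end

theory Submission
  imports Defs
    "HOL-Algebra.Multiplicative_Group"
    "HOL-Computational_Algebra.Fundamental_Theorem_Algebra"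
    "HOL-Complex_Analysis.Complex_Analysis"
begin

text \<open>
  The hypothesis on spectra is first turned into two purely group-theoretic facts; a theorem on
  finite groups then yields a normal abelian subgroup that contains every group commutator, and
  diagonalising that subgroup gives the monomial form.

  \<^bold>\<open>From spectra to group theory.\<close> The ring commutator of \<open>A\<close> and \<open>B A\<inverse>\<close> is \<open>A B A\<inverse> - B\<close>, so the
  difference of two conjugates \<open>B' = A B A\<inverse>\<close> and \<open>B\<close>, and likewise of their squares, has real
  spectrum. Eigenvalues of members of a bounded group have modulus 1. On a common eigenvector of
  \<open>B'\<close> and \<open>B\<close>, with eigenvalues \<open>b'\<close> and \<open>b\<close>, both \<open>b' - b\<close> and \<open>b'\<^sup>2 - b\<^sup>2\<close> are real, which forces
  \<open>b' = b\<close> or \<open>b' = -b = \<plusminus>1\<close>. Hence (a) if \<open>B\<close> commutes with \<open>A B A\<inverse>\<close>, then \<open>A\<close> commutes with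
  \<open>B\<^sup>2\<close> (lemma \<open>commutes_with_square\<close>), and (b) a group commutator of \<open>A\<close> and \<open>B\<close> that commutes with
  \<open>A\<close> and \<open>B\<close> is trivial (\<open>central_commutator_trivial\<close>). In (b) the critical case is \<open>A B = - B A\<close>: then
  \<open>A\<close>, \<open>B\<close> and \<open>A B\<close> all have eigenvalues \<open>\<plusminus>1\<close> only, while \<open>(A B)\<^sup>2 = - A\<^sup>2 B\<^sup>2\<close>.

  \<^bold>\<open>Finiteness modulo scalars.\<close> Members of the group that are close to the identity commute
  (\<open>commute_near_identity\<close>). Otherwise the normalised differences
  \<open>(K\<^sub>k - 1) / \<parallel>K\<^sub>k - 1\<parallel>\<close> of nontrivial group commutators \<open>K\<^sub>k\<close> tending to 1 accumulate at a matrix \<open>N\<close>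
  of norm 1. As a limit of real multiples of ring commutators, \<open>N\<close> has real spectrum (Hurwitz); as a
  tangent vector to a group that preserves a norm, it is semisimple with imaginary spectrum; so
  \<open>N = 0\<close>. By (a) members close to the identity are then central, hence scalar, and compactness shows
  that the group is finite modulo scalars. Its scalar multiples of determinant 1 form a finite group
  that still satisfies (a) and (b).

  \<^bold>\<open>Finite groups with (a) and (b).\<close> The involutions of such a group commute, and modulo the normal
  subgroup \<open>invols\<close> that they form with 1, commuting conjugates are equal. A counting argument shows that a
  finite group in which commuting conjugates are equal is abelian
  (\<open>abelian_if_commuting_conjugates_equal\<close>). So every commutator lies in \<open>invols\<close> (\<open>commutator_involution\<close>).

  \<^bold>\<open>Monomial form.\<close> The involutions of determinant 1 in the given group form, with 1, a normal
  commuting family that contains all group commutators. The stabiliser of one of its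
  weight spaces acts there by commuting operators, again because \<open>A B = - B A\<close> is impossible. It
  has a common eigenvector, on which all its members act by \<open>\<plusminus>1\<close>; and the orbit of that vector
  consists, up to sign, of the vectors of a basis (\<open>monomial_basis\<close>). Group commutators act on every basis
  vector by \<open>\<plusminus>1\<close>, which makes the permutations of the basis commute.
\<close>

(* The infix dollar sign denotes vector components throughout. *)
unbundle no fps_syntax

section \<open>Finite groups in which commuting conjugates coincide\<close>

context group
begin

definition cj :: "'a \<Rightarrow> 'a \<Rightarrow> 'a" where
  "cj g x = g \<otimes> x \<otimes> inv g"

lemma cancel_inv_left [simp]:
  assumes "x \<in> carrier G" "y \<in> carrier G"
  shows "x \<otimes> (inv x \<otimes> y) = y" "inv x \<otimes> (x \<otimes> y) = y"
  using assms by (simp_all add: m_assoc [symmetric])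

lemma cj_closed [simp]: "g \<in> carrier G \<Longrightarrow> x \<in> carrier G \<Longrightarrow> cj g x \<in> carrier G"
  by (simp add: cj_def)

lemma cj_mult: "g \<in> carrier G \<Longrightarrow> x \<in> carrier G \<Longrightarrow> y \<in> carrier G
    \<Longrightarrow> cj g (x \<otimes> y) = cj g x \<otimes> cj g y"
  by (simp add: cj_def m_assoc)

lemma cj_cj: "g \<in> carrier G \<Longrightarrow> h \<in> carrier G \<Longrightarrow> x \<in> carrier G
    \<Longrightarrow> cj g (cj h x) = cj (g \<otimes> h) x"
  by (simp add: cj_def m_assoc inv_mult_group)

lemma cj_one [simp]: "x \<in> carrier G \<Longrightarrow> cj \<one> x = x" "g \<in> carrier G \<Longrightarrow> cj g \<one> = \<one>"
  by (simp_all add: cj_def)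

lemma cj_pow: "g \<in> carrier G \<Longrightarrow> x \<in> carrier G \<Longrightarrow> cj g (x [^] (n::nat)) = cj g x [^] n"
  by (induction n) (simp_all add: cj_mult)

lemma cj_eq_iff_commute: "g \<in> carrier G \<Longrightarrow> x \<in> carrier G \<Longrightarrow> cj g x = x \<longleftrightarrow> g \<otimes> x = x \<otimes> g"
  unfolding cj_def by (metis inv_closed inv_solve_right m_closed)

definition Cent :: "'a set \<Rightarrow> 'a \<Rightarrow> 'a set" where
  "Cent H x = {h \<in> H. h \<otimes> x = x \<otimes> h}"

lemma subgroup_Cent:
  assumes "subgroup H G" "x \<in> H"
  shows "subgroup (Cent H x) G"
proof -
  interpret H: subgroup H G by fact
  have x: "x \<in> carrier G" using assms by auto
  show ?thesis
  proof (rule subgroupI)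
    show "Cent H x \<subseteq> carrier G" by (auto simp: Cent_def)
    show "Cent H x \<noteq> {}" using assms(2) by (auto simp: Cent_def)
  next
    fix a assume "a \<in> Cent H x"
    then have a: "a \<in> H" "a \<otimes> x = x \<otimes> a" "a \<in> carrier G" by (auto simp: Cent_def)
    have "inv a \<otimes> x = x \<otimes> inv a"
      using a x by (metis inv_closed inv_solve_left inv_solve_right m_assoc m_closed)
    then show "inv a \<in> Cent H x" using a by (simp add: Cent_def)
  next
    fix a b assume "a \<in> Cent H x" "b \<in> Cent H x"
    then have a: "a \<in> H" "a \<otimes> x = x \<otimes> a" "a \<in> carrier G"
      and b: "b \<in> H" "b \<otimes> x = x \<otimes> b" "b \<in> carrier G" by (auto simp: Cent_def)
    have "a \<otimes> b \<otimes> x = x \<otimes> (a \<otimes> b)"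
      using a b x by (metis m_assoc)
    then show "a \<otimes> b \<in> Cent H x" using a b by (simp add: Cent_def)
  qed
qed

text \<open>The proof is by induction on the order of the subgroup. In a nonabelian \<open>H\<close> with centre \<open>Z\<close> all
  centralisers of noncentral elements are abelian by induction; hence commutation is an equivalence
  relation on \<open>H - Z\<close>, with the sets \<open>Cent H x - Z\<close> as its classes. The conjugates of one class cover
  exactly \<open>card H * (1 - card Z / card (Cent H x))\<close> elements: if \<open>h c h\<inverse> = h' c' h'\<inverse>\<close> with \<open>c\<close> and \<open>c'\<close> in the
  same class, then \<open>c\<close> and \<open>c'\<close> are commuting conjugates, so they are equal. This is at least half of
  \<open>H\<close> but misses some noncentral \<open>y\<close>. The conjugates of the class of \<open>y\<close> are a second such set, disjoint
  from the first, and the two leave no room for \<open>Z\<close>.\<close>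

lemma abelian_if_commuting_conjugates_equal:
  assumes fin: "finite (carrier G)"
    and cc: "\<And>g x. g \<in> carrier G \<Longrightarrow> x \<in> carrier G \<Longrightarrow> cj g x \<otimes> x = x \<otimes> cj g x \<Longrightarrow> cj g x = x"
    and "subgroup H G"
  shows "\<forall>x\<in>H. \<forall>y\<in>H. x \<otimes> y = y \<otimes> x"
  using \<open>subgroup H G\<close>
proof (induction "card H" arbitrary: H rule: less_induct)
  case (less H)
  interpret H: subgroup H G by fact
  have HG: "x \<in> carrier G" if "x \<in> H" for x using that by (rule H.mem_carrier)
  have finH: "finite H" using fin H.subset finite_subset by blast
  define Z where "Z = {z \<in> H. \<forall>h\<in>H. z \<otimes> h = h \<otimes> z}"
  have ZH: "Z \<subseteq> H" by (auto simp: Z_def)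
  have cj_closedH: "cj g x \<in> H" if "g \<in> H" "x \<in> H" for g x
    using that by (simp add: cj_def)
  have cjZ: "cj g x = x" if "g \<in> H" "x \<in> Z" for g x
    using that ZH HG by (subst cj_eq_iff_commute) (auto simp: Z_def)
  have cj_notZ: "cj g x \<notin> Z" if "g \<in> H" "x \<in> H" "x \<notin> Z" for g x
  proof
    assume "cj g x \<in> Z"
    then have "cj (inv g) (cj g x) = cj g x" using that by (intro cjZ) auto
    then have "x = cj g x" using that HG by (simp add: cj_cj)
    with \<open>cj g x \<in> Z\<close> that show False by simp
  qed
  show ?case
  proof (rule ccontr)
    assume nonab: "\<not> ?case"
    have C_ab: "a \<otimes> b = b \<otimes> a" if x: "x \<in> H" "x \<notin> Z" and a: "a \<in> Cent H x" "b \<in> Cent H x" for x a b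
    proof -
      have "Cent H x \<noteq> H" using x unfolding Z_def Cent_def by (smt (verit) mem_Collect_eq)
      then have "Cent H x \<subset> H" by (auto simp: Cent_def)
      then have "card (Cent H x) < card H" by (rule psubset_card_mono [OF finH])
      then show ?thesis using less.hyps subgroup_Cent [OF less.prems x(1)] a by blast
    qed
    have self: "x \<in> Cent H x" if "x \<in> H" for x using that by (simp add: Cent_def)
    have C_sub: "Cent H c \<subseteq> Cent H x" if "x \<in> H" "x \<notin> Z" "c \<in> Cent H x" "c \<notin> Z" for x c
    proof
      fix h assume h: "h \<in> Cent H c"
      have c: "c \<in> H" "x \<in> Cent H c" using that by (auto simp: Cent_def)
      show "h \<in> Cent H x" using C_ab [OF c(1) \<open>c \<notin> Z\<close> h c(2)] h by (simp add: Cent_def)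
    qed
    have CZ: "Z \<subseteq> Cent H x" if "x \<in> H" for x using that by (auto simp: Z_def Cent_def)
    define S where "S x = (\<lambda>(h, c). cj h c) ` (H \<times> (Cent H x - Z))" for x
    have finC: "finite (Cent H x)" for x using finH by (simp add: Cent_def)
    have Ssub: "S x \<subseteq> H - Z" for x
      using cj_closedH cj_notZ by (auto simp: S_def Cent_def)
    have cardS: "card (S x) * card (Cent H x) = card H * (card (Cent H x) - card Z)"
      if x: "x \<in> H" "x \<notin> Z" for x
    proof -
      let ?D = "H \<times> (Cent H x - Z)" and ?f = "\<lambda>(h, c). cj h c"
      have fib: "card {p \<in> ?D. ?f p = y} = card (Cent H x)" if "y \<in> S x" for y
      proof -
        obtain h c where hc: "h \<in> H" "c \<in> Cent H x" "c \<notin> Z" "y = cj h c"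
          using \<open>y \<in> S x\<close> by (auto simp: S_def)
        have cH: "c \<in> H" using hc by (simp add: Cent_def)
        have "{p \<in> ?D. ?f p = y} = (\<lambda>k. (h \<otimes> k, c)) ` Cent H x" (is "?L = ?R")
        proof
          show "?L \<subseteq> ?R"
          proof
            fix p assume "p \<in> ?L"
            then obtain h' c' where p: "p = (h', c')"
              and h': "h' \<in> H" "c' \<in> Cent H x" "c' \<notin> Z" "cj h' c' = y" by auto
            have c'H: "c' \<in> H" using h' by (simp add: Cent_def)
            let ?k = "inv h \<otimes> h'"
            have "cj ?k c' = cj (inv h) (cj h' c')"
              using h'(1) hc(1) c'H HG by (simp add: cj_cj)
            also have "\<dots> = c" using h' hc cH HG by (simp add: cj_cj)
            finally have k: "cj ?k c' = c" .
            have "c \<otimes> c' = c' \<otimes> c" using C_ab [OF x hc(2) h'(2)] .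
            then have "cj ?k c' = c'" using k h' hc c'H HG by (intro cc) auto
            then have cc': "c = c'" using k by simp
            have "?k \<in> Cent H c"
              using k cc' h' hc cH HG cj_eq_iff_commute [of ?k c] by (simp add: Cent_def)
            then have "?k \<in> Cent H x" using C_sub [OF x hc(2,3)] by blast
            moreover have "h' = h \<otimes> ?k" using h' hc HG by simp
            ultimately show "p \<in> ?R" using cc' p by blast
          qed
          show "?R \<subseteq> ?L"
          proof
            fix p assume "p \<in> ?R"
            then obtain k where p: "p = (h \<otimes> k, c)" and k: "k \<in> Cent H x" by blast
            then have kH: "k \<in> H" by (simp add: Cent_def)
            have "k \<otimes> c = c \<otimes> k" using C_ab [OF x k hc(2)] .
            then have "cj k c = c" using kH cH HG by (simp add: cj_eq_iff_commute)
            then have "cj (h \<otimes> k) c = y" using hc kH cH HG by (metis cj_cj)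
            then show "p \<in> ?L" using hc(1-3) kH p by simp
          qed
        qed
        moreover have "inj_on (\<lambda>k. (h \<otimes> k, c)) (Cent H x)"
          using hc HG by (auto simp: inj_on_def Cent_def)
        ultimately show ?thesis by (simp add: card_image)
      qed
      have "card ?D = (\<Sum>y\<in>S x. card {p \<in> ?D. ?f p = y})"
        unfolding S_def using finH finC sum.image_gen [of ?D "\<lambda>_. 1::nat" ?f] by simp
      then show ?thesis
        using fib finH ZH CZ [OF x(1)] finite_subset [OF ZH finH]
        by (simp add: card_cartesian_product card_Diff_subset)
    qed
    have half: "card H \<le> 2 * card (S x)" if x: "x \<in> H" "x \<notin> Z" for x
    proof -
      have Zx: "z \<otimes> x \<in> Cent H x - Z" if z: "z \<in> Z" for z
      proof -
        have zH: "z \<in> H" using z ZH by blast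
        have 1: "z \<otimes> x \<in> Cent H x"
          using z zH x HG by (auto simp: Cent_def Z_def m_assoc)
        have "x \<in> Z" if zx: "z \<otimes> x \<in> Z"
        proof -
          have "x \<otimes> h = h \<otimes> x" if h: "h \<in> H" for h
          proof -
            have "z \<otimes> (x \<otimes> h) = z \<otimes> x \<otimes> h" using zH x h HG by (simp add: m_assoc)
            also have "\<dots> = h \<otimes> (z \<otimes> x)" using zx h by (simp add: Z_def)
            also have "\<dots> = h \<otimes> z \<otimes> x" using zH x h HG by (simp add: m_assoc)
            also have "\<dots> = z \<otimes> h \<otimes> x" using z h by (simp add: Z_def)
            also have "\<dots> = z \<otimes> (h \<otimes> x)" using zH x h HG by (simp add: m_assoc)
            finally show ?thesis using zH x h HG by simp
          qed
          then show ?thesis using x by (simp add: Z_def)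
        qed
        then show ?thesis using 1 x by blast
      qed
      have "card Z = card ((\<lambda>z. z \<otimes> x) ` Z)"
        by (intro card_image [symmetric] inj_onI) (metis HG ZH right_cancel subsetD x(1))
      also have "\<dots> \<le> card (Cent H x - Z)" using Zx finC by (intro card_mono) auto
      also have "\<dots> = card (Cent H x) - card Z"
        using CZ x finite_subset [OF ZH finH] by (simp add: card_Diff_subset)
      finally have "card (Cent H x) \<le> 2 * (card (Cent H x) - card Z)" by linarith
      then have "card H * card (Cent H x) \<le> 2 * (card H * (card (Cent H x) - card Z))"
        by simp
      also have "\<dots> = 2 * card (S x) * card (Cent H x)" using cardS [OF x] by simp
      finally have "card H * card (Cent H x) \<le> 2 * card (S x) * card (Cent H x)" .
      moreover have "card (Cent H x) > 0" using self [OF x(1)] finC by (auto simp: card_gt_0_iff)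
      ultimately show ?thesis by simp
    qed
    obtain x where x: "x \<in> H" "x \<notin> Z" using nonab by (auto simp: Z_def)
    have Zpos: "card Z > 0" using ZH finH finite_subset H.one_closed HG
      by (auto simp: card_gt_0_iff Z_def intro!: exI [of _ \<one>])
    (* Otherwise the count would give Cent H x the order of H. *)
    have "\<exists>y\<in>H - Z. y \<notin> S x"
    proof (rule ccontr)
      assume "\<not> ?thesis"
      then have "S x = H - Z" using Ssub by blast
      then have "card (S x) = card H - card Z"
        using ZH finH finite_subset by (metis card_Diff_subset)
      then have "(card H - card Z) * card (Cent H x) = card H * (card (Cent H x) - card Z)"
        using cardS [OF x] by simp
      then have "card H * card (Cent H x) - card Z * card (Cent H x)
          = card H * card (Cent H x) - card H * card Z"
        by (simp add: diff_mult_distrib diff_mult_distrib2)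
      moreover have "card Z * card (Cent H x) \<le> card H * card (Cent H x)"
        using card_mono [OF finH ZH] by simp
      moreover have "card H * card Z \<le> card H * card (Cent H x)"
        using card_mono [OF finC CZ [OF x(1)]] by simp
      ultimately have "card Z * card (Cent H x) = card H * card Z" by linarith
      then have "card (Cent H x) = card H" using Zpos by simp
      then have "Cent H x = H" using finH by (intro card_subset_eq) (auto simp: Cent_def)
      then show False using x unfolding Z_def Cent_def by (smt (verit) mem_Collect_eq)
    qed
    then obtain y where y: "y \<in> H" "y \<notin> Z" "y \<notin> S x" by blast
    have "S x \<inter> S y = {}"
    proof (rule ccontr)
      assume "S x \<inter> S y \<noteq> {}"
      then obtain h c h' c' where e: "cj h c = cj h' c'" "h \<in> H" "h' \<in> H"
        "c \<in> Cent H x" "c \<notin> Z" "c' \<in> Cent H y" "c' \<notin> Z"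
        by (auto simp: S_def)
      have cH: "c \<in> H" "c' \<in> H" using e by (auto simp: Cent_def)
      let ?g = "inv h' \<otimes> h"
      have gH: "?g \<in> H" using e by simp
      have c': "c' = cj ?g c"
        using e cH HG by (metis H.m_inv_closed cj_cj cj_one(1) l_inv)
      let ?y = "cj (inv ?g) y"
      have "c = cj (inv ?g) c'" using c' cH gH HG by (simp add: cj_cj)
      moreover have "cj (inv ?g) (c' \<otimes> y) = cj (inv ?g) (y \<otimes> c')"
        using e by (simp add: Cent_def)
      ultimately have "c \<otimes> ?y = ?y \<otimes> c" using cH gH HG y by (simp add: cj_mult)
      then have "?y \<in> Cent H c" using cj_closedH gH y by (simp add: Cent_def)
      then have "?y \<in> Cent H x" using C_sub [OF x e(4,5)] by blast
      moreover have "?y \<notin> Z" using cj_notZ gH y by simp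
      moreover have "y = cj ?g ?y" using gH y HG by (simp add: cj_cj)
      ultimately have "(?g, ?y) \<in> H \<times> (Cent H x - Z)" "y = (\<lambda>(h, c). cj h c) (?g, ?y)"
        using gH by simp_all
      then have "y \<in> S x" unfolding S_def by (rule rev_image_eqI)
      with y show False by blast
    qed
    then have "card (S x) + card (S y) = card (S x \<union> S y)"
      using Ssub finH by (metis card_Un_disjoint finite_Diff finite_subset)
    also have "\<dots> \<le> card (H - Z)" using Ssub finH by (intro card_mono) auto
    also have "\<dots> = card H - card Z" using ZH finH finite_subset by (metis card_Diff_subset)
    also have "\<dots> < card H" using Zpos card_mono [OF finH ZH] by linarith
    finally show False using half [OF x] half [OF y(1,2)] by linarith
  qed
qed

end

section \<open>Rigid groups: commutators are involutions\<close>

lemma two_power_times_odd: "n > 0 \<Longrightarrow> \<exists>k m. n = 2 ^ k * m \<and> odd m" for n :: nat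
proof (induction n rule: less_induct)
  case (less n)
  show ?case
  proof (cases "odd n")
    case True then show ?thesis by (intro exI [of _ 0] exI [of _ n]) simp
  next
    case False
    then obtain r where r: "n = 2 * r" by (auto elim: evenE)
    then have "r < n" "r > 0" using less.prems by auto
    then obtain k m where "r = 2 ^ k * m" "odd m" using less.IH by blast
    with r show ?thesis by (intro exI [of _ "Suc k"] exI [of _ m]) simp
  qed
qed

context group
begin

text \<open>Written additively, \<open>e \<mapsto> a e b\<close> is an affine map of the vector space \<open>E\<close> over the field with two
  elements, of odd order \<open>m\<close>. In characteristic two the sum of an odd number of points is an affine
  combination, so the sum of the \<open>m\<close> points of the orbit of 0 is a fixed point. This replaces the
  conjugacy part of the Schur--Zassenhaus theorem below.\<close>

lemma affine_fixed_point:
  assumes E: "subgroup E G"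
    and comm: "\<And>x y. x \<in> E \<Longrightarrow> y \<in> E \<Longrightarrow> x \<otimes> y = y \<otimes> x"
    and sq: "\<And>x. x \<in> E \<Longrightarrow> x \<otimes> x = \<one>"
    and norm: "\<And>g x. g \<in> carrier G \<Longrightarrow> x \<in> E \<Longrightarrow> cj g x \<in> E"
    and ab: "a \<in> carrier G" "b \<in> carrier G" "a \<otimes> b \<in> E"
    and m: "odd m" "a [^] (m::nat) = \<one>" "b [^] m = \<one>"
  obtains e where "e \<in> E" "a \<otimes> e \<otimes> b = e"
proof -
  interpret E: subgroup E G by fact
  have EG: "x \<in> carrier G" if "x \<in> E" for x using that by (rule E.mem_carrier)
  define f where "f x = a \<otimes> x \<otimes> b" for x
  have f_cj: "f x = cj a x \<otimes> (a \<otimes> b)" if "x \<in> E" for x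
    using that ab EG by (simp add: f_def cj_def m_assoc)
  have fE: "f x \<in> E" if "x \<in> E" for x
    using that ab norm by (simp add: f_cj)
  have f3: "f (x \<otimes> y \<otimes> z) = f x \<otimes> f y \<otimes> f z" if "x \<in> E" "y \<in> E" "z \<in> E" for x y z
  proof -
    define c x' y' z' where d: "c = a \<otimes> b" "x' = cj a x" "y' = cj a y" "z' = cj a z"
    have in_E: "c \<in> E" "x' \<in> E" "y' \<in> E" "z' \<in> E" using ab that norm by (auto simp: d)
    have "f x \<otimes> f y \<otimes> f z = x' \<otimes> c \<otimes> (y' \<otimes> c) \<otimes> (z' \<otimes> c)"
      using that by (simp add: f_cj d)
    also have "\<dots> = x' \<otimes> (c \<otimes> y') \<otimes> (c \<otimes> z') \<otimes> c"
      using in_E EG by (simp add: m_assoc)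
    also have "\<dots> = x' \<otimes> (y' \<otimes> c) \<otimes> (c \<otimes> z') \<otimes> c"
      using in_E comm by metis
    also have "\<dots> = x' \<otimes> y' \<otimes> (c \<otimes> c) \<otimes> z' \<otimes> c"
      using in_E EG by (simp add: m_assoc)
    also have "\<dots> = x' \<otimes> y' \<otimes> z' \<otimes> c"
      using in_E EG sq by simp
    also have "\<dots> = f (x \<otimes> y \<otimes> z)"
      using that ab EG by (simp add: f_cj d cj_mult)
    finally show ?thesis by simp
  qed
  define w where "w k = a [^] (k::nat) \<otimes> b [^] k" for k
  have fw: "f (w k) = w (Suc k)" for k
    unfolding f_def w_def nat_pow_Suc2 [OF ab(1)] using ab by (simp add: m_assoc)
  have wE: "w k \<in> E" for k
  proof (induction k)
    case 0 show ?case by (simp add: w_def)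
  next
    case (Suc k) then show ?case using fE fw by metis
  qed
  (* Here w k is the k-th point of the orbit of the identity and s j the product of w 0, ..., w (2 j), an odd number of factors. *)
  define s where "s = rec_nat (w 0) (\<lambda>j r. r \<otimes> w (2 * j + 1) \<otimes> w (2 * j + 2))"
  have s0: "s 0 = w 0" and sS: "s (Suc j) = s j \<otimes> w (2 * j + 1) \<otimes> w (2 * j + 2)" for j
    by (simp_all add: s_def)
  have sE: "s j \<in> E" for j
    by (induction j) (simp_all add: s0 sS wE)
  have fsE: "f (s j) \<in> E" for j using sE fE by blast
  have shift: "w 0 \<otimes> f (s j) = s j \<otimes> w (2 * j + 1)" for j
  proof (induction j)
    case 0
    then show ?case by (simp add: s0 fw)
  next
    case (Suc j)
    have "w 0 \<otimes> f (s (Suc j)) = w 0 \<otimes> (f (s j) \<otimes> w (2 * j + 2) \<otimes> w (2 * j + 3))"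
      using f3 [OF sE wE wE, of j "2 * j + 1" "2 * j + 2"] by (simp add: sS fw numeral_3_eq_3)
    also have "\<dots> = w 0 \<otimes> f (s j) \<otimes> w (2 * j + 2) \<otimes> w (2 * j + 3)"
      using EG [OF wE] EG [OF fsE] by (simp add: m_assoc)
    also have "\<dots> = s (Suc j) \<otimes> w (2 * Suc j + 1)"
      using Suc.IH by (simp add: sS numeral_3_eq_3)
    finally show ?case .
  qed
  obtain j where j: "m = 2 * j + 1" using m by (auto elim: oddE)
  have w: "w 0 = \<one>" "w (2 * j + 1) = \<one>" using m(2,3) j by (simp_all add: w_def)
  have "a \<otimes> s j \<otimes> b = s j"
    using shift [of j] EG [OF sE] EG [OF fsE] unfolding w by (simp add: f_def)
  then show ?thesis using sE that by blast
qed

end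

text \<open>The two group-theoretic consequences of the spectral hypothesis. The first says that conjugating
  \<open>x\<close> to an element that commutes with \<open>x\<close> fixes \<open>x\<^sup>2\<close>. The second implies for example that all
  nilpotent subgroups are abelian.\<close>

locale rigid_group = group +
  assumes fin: "finite (carrier G)"
    and commuting_conjugate: "\<And>g x. g \<in> carrier G \<Longrightarrow> x \<in> carrier G \<Longrightarrow>
        cj g x \<otimes> x = x \<otimes> cj g x \<Longrightarrow> g \<otimes> (x \<otimes> x) = x \<otimes> x \<otimes> g"
    and central_commutator: "\<And>x y k. x \<in> carrier G \<Longrightarrow> y \<in> carrier G \<Longrightarrow> k = cj x y \<otimes> inv y
        \<Longrightarrow> k \<otimes> x = x \<otimes> k \<Longrightarrow> k \<otimes> y = y \<otimes> k \<Longrightarrow> k = \<one>"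
begin

definition invols where "invols = {x \<in> carrier G. x \<otimes> x = \<one>}"

lemma invols_carrier: "x \<in> invols \<Longrightarrow> x \<in> carrier G" by (simp add: invols_def)

lemma invols_sq: "x \<in> invols \<Longrightarrow> x \<otimes> x = \<one>" by (simp add: invols_def)

lemma invols_inv: "x \<in> invols \<Longrightarrow> inv x = x"
  using invols_carrier invols_sq inv_equality by blast

text \<open>The product \<open>r\<close> of two involutions is inverted by each of them, so \<open>commuting_conjugate\<close> applies to
  \<open>r\<close> and gives \<open>r\<^sup>4 = 1\<close>. Then the commutator \<open>r\<^sup>2\<close> is central in the dihedral group generated by
  them.\<close>

lemma invols_comm:
  assumes s: "s \<in> invols" and t: "t \<in> invols"
  shows "s \<otimes> t = t \<otimes> s"
proof -
  define r where "r = s \<otimes> t"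
  have c: "s \<in> carrier G" "t \<in> carrier G" "r \<in> carrier G" using s t invols_carrier by (auto simp: r_def)
  have ir: "inv r = t \<otimes> s" using s t c by (simp add: r_def inv_mult_group invols_inv)
  have cr: "cj s r = inv r"
    using c s invols_sq [OF s] unfolding ir by (simp add: cj_def r_def invols_inv m_assoc [symmetric])
  have "s \<otimes> (r \<otimes> r) = r \<otimes> r \<otimes> s"
    using c cr by (intro commuting_conjugate) auto
  then have "cj s (r \<otimes> r) = r \<otimes> r" using c by (simp add: cj_eq_iff_commute)
  then have rr: "r \<otimes> r = inv r \<otimes> inv r" using c cr by (simp add: cj_mult)
  define k where "k = cj s r \<otimes> inv r"
  have k: "k = r \<otimes> r" using cr rr by (simp add: k_def)
  have "k = \<one>"
  proof (rule central_commutator [OF c(1,3) k_def])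
    show "k \<otimes> s = s \<otimes> k" unfolding k using \<open>s \<otimes> (r \<otimes> r) = r \<otimes> r \<otimes> s\<close> by simp
    show "k \<otimes> r = r \<otimes> k" unfolding k using c by (simp add: m_assoc)
  qed
  then have "inv r = r" using k c inv_equality by metis
  then show ?thesis using ir by (simp add: r_def)
qed

lemma subgroup_invols: "subgroup invols G"
proof (rule subgroupI)
  show "invols \<subseteq> carrier G" using invols_carrier by blast
  show "invols \<noteq> {}" by (auto simp: invols_def intro!: exI [of _ \<one>])
next
  fix a assume "a \<in> invols" then show "inv a \<in> invols" by (simp add: invols_inv)
next
  fix a b assume a: "a \<in> invols" and b: "b \<in> invols"
  have "a \<otimes> b \<otimes> (a \<otimes> b) = a \<otimes> (b \<otimes> a) \<otimes> b"
    using invols_carrier [OF a] invols_carrier [OF b] by (simp add: m_assoc)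
  also have "\<dots> = a \<otimes> a \<otimes> (b \<otimes> b)"
    unfolding invols_comm [OF b a] using invols_carrier [OF a] invols_carrier [OF b] by (simp add: m_assoc)
  also have "\<dots> = \<one>" using invols_sq a b invols_carrier by simp
  finally show "a \<otimes> b \<in> invols" using invols_carrier a b by (simp add: invols_def)
qed

lemma cj_invols: "g \<in> carrier G \<Longrightarrow> x \<in> invols \<Longrightarrow> cj g x \<in> invols"
  using cj_mult [of g x x] by (simp add: invols_def)

lemma normal_invols: "invols \<lhd> G"
  using subgroup_invols cj_invols by (auto simp: normal_inv_iff cj_def)

lemma invols_fixed_point:
  assumes "a \<in> carrier G" "b \<in> carrier G" "a \<otimes> b \<in> invols"
    and "odd m" "a [^] (m::nat) = \<one>" "b [^] m = \<one>"
  obtains e where "e \<in> invols" "a \<otimes> e \<otimes> b = e"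
  using affine_fixed_point [OF subgroup_invols invols_comm invols_sq cj_invols assms] by blast

definition proj where "proj x = invols #> x"

definition Q where "Q = G Mod invols"

sublocale Q: group Q
  unfolding Q_def using normal_invols by (rule normal.factorgroup_is_group)

sublocale proj: group_hom G Q proj
proof -
  have "proj \<in> hom G Q"
    using normal.r_coset_hom_Mod [OF normal_invols] by (simp add: proj_def [abs_def] Q_def)
  then show "group_hom G Q proj"
    by unfold_locales
qed

lemma proj_surj: "carrier Q = proj ` carrier G"
  by (simp add: Q_def proj_def [abs_def] carrier_FactGroup)

lemma proj_one_iff: "x \<in> carrier G \<Longrightarrow> proj x = \<one>\<^bsub>Q\<^esub> \<longleftrightarrow> x \<in> invols"
  unfolding proj_def Q_def
  using coset_join1 coset_join2 subgroup_invols subgroup.subset by (metis one_FactGroup)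

lemma proj_invols: "x \<in> invols \<Longrightarrow> proj x = \<one>\<^bsub>Q\<^esub>"
  using proj_one_iff invols_carrier by blast

lemma proj_eq_iff:
  assumes "x \<in> carrier G" "y \<in> carrier G"
  shows "proj x = proj y \<longleftrightarrow> x \<otimes> inv y \<in> invols"
proof -
  have "x \<otimes> inv y \<in> invols \<longleftrightarrow> proj x \<otimes>\<^bsub>Q\<^esub> inv\<^bsub>Q\<^esub> proj y = \<one>\<^bsub>Q\<^esub>"
    using assms proj_one_iff [of "x \<otimes> inv y"] by simp
  also have "\<dots> \<longleftrightarrow> proj x = proj y"
    using assms Q.inv_solve_right' [of "\<one>\<^bsub>Q\<^esub>" "proj x" "proj y"] by auto
  finally show ?thesis by simp
qed

lemma proj_commute_iff:
  assumes "x \<in> carrier G" "y \<in> carrier G"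
  shows "proj x \<otimes>\<^bsub>Q\<^esub> proj y = proj y \<otimes>\<^bsub>Q\<^esub> proj x \<longleftrightarrow> cj x y \<otimes> inv y \<in> invols"
proof -
  have "proj x \<otimes>\<^bsub>Q\<^esub> proj y = proj y \<otimes>\<^bsub>Q\<^esub> proj x \<longleftrightarrow> proj (x \<otimes> y) = proj (y \<otimes> x)"
    using assms by simp
  also have "\<dots> \<longleftrightarrow> x \<otimes> y \<otimes> inv (y \<otimes> x) \<in> invols" using assms by (intro proj_eq_iff) auto
  also have "x \<otimes> y \<otimes> inv (y \<otimes> x) = cj x y \<otimes> inv y"
    using assms by (simp add: cj_def inv_mult_group m_assoc)
  finally show ?thesis .
qed

text \<open>Let \<open>B'\<close> be the conjugate of \<open>B\<close>. Modulo involutions the two commute. One fixed point argument moves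
  \<open>B'\<close> inside its coset to an element that commutes with \<open>B\<close>; a power \<open>y\<close> of the latter has order
  dividing \<open>m\<close>, and a second fixed point argument shows that \<open>y\<close> is conjugate to \<open>B'\<close>, hence to \<open>B\<close>.
  So \<open>y\<close> and \<open>B\<close> are commuting conjugates, \<open>y\<^sup>2 = B\<^sup>2\<close> by \<open>commuting_conjugate\<close>, and \<open>y = B\<close> because
  the order is odd.\<close>

lemma odd_rigid:
  assumes g: "g \<in> carrier G" and B: "B \<in> carrier G" and m: "odd m" "B [^] (m::nat) = \<one>"
    and comm: "proj B \<otimes>\<^bsub>Q\<^esub> proj (cj g B) = proj (cj g B) \<otimes>\<^bsub>Q\<^esub> proj B"
  shows "proj (cj g B) = proj B"
proof -
  define B' where "B' = cj g B"
  have B': "B' \<in> carrier G" "B' [^] m = \<one>"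
    using g B m cj_pow [of g B m] by (auto simp: B'_def)
  define b where "b = cj B' (inv B)"
  have b: "b \<in> carrier G" using B B' by (simp add: b_def)
  have bm: "b [^] m = \<one>"
    unfolding b_def using B B' m by (simp add: cj_pow [symmetric] nat_pow_inv)
  have "B \<otimes> b \<in> invols"
  proof -
    have "B \<otimes> b = cj B B' \<otimes> inv B'" using B B' by (simp add: b_def cj_def m_assoc)
    then show ?thesis using comm proj_commute_iff [OF B B'(1)] by (simp add: B'_def)
  qed
  then obtain e where e: "e \<in> invols" "B \<otimes> e \<otimes> b = e"
    using invols_fixed_point [OF B b _ m(1,2) bm] by blast
  note eG = invols_carrier [OF e(1)]
  define x where "x = e \<otimes> B'"
  have x: "x \<in> carrier G" using eG B' by (simp add: x_def)
  have Bx: "B \<otimes> x = x \<otimes> B"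
  proof -
    have "B \<otimes> e \<otimes> b \<otimes> (B' \<otimes> B) = B \<otimes> e \<otimes> B'"
      using B B' eG by (simp add: b_def cj_def m_assoc)
    then show ?thesis using e B B' eG by (simp add: x_def m_assoc)
  qed
  have px: "proj x = proj B'" using eG B' e by (simp add: x_def proj_invols)
  have "proj (x [^] m) = \<one>\<^bsub>Q\<^esub>"
    using x B' px by (metis proj.hom_nat_pow proj.hom_one)
  then have xm: "x [^] m \<otimes> x [^] m = \<one>" using x proj_one_iff by (simp add: invols_def)
  (* As m + 1 is even and congruent to 1 modulo m, this power kills the 2-part of x and keeps its coset. *)
  define y where "y = x [^] (m + 1)"
  have y: "y \<in> carrier G" using x by (simp add: y_def)
  obtain j where j: "m + 1 = 2 * j" using m by (metis dvdE odd_even_add odd_one)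
  have ym: "y [^] m = \<one>"
  proof -
    have "y = x [^] (2 * j)" by (simp only: y_def j)
    then have "y [^] m = ((x [^] m) [^] (2::nat)) [^] j"
      using x by (simp add: nat_pow_pow mult_ac)
    then show ?thesis using xm x by (simp add: numeral_2_eq_2)
  qed
  have py: "proj y = proj B'"
    using x B' px proj.hom_nat_pow [of x "m+1"] proj.hom_nat_pow [of B' "m+1"] by (simp add: y_def)
  have "y \<otimes> inv B' \<in> invols" using py proj_eq_iff y B' by blast
  moreover have "inv B' [^] m = \<one>" using B' by (simp add: nat_pow_inv)
  ultimately obtain e' where e': "e' \<in> invols" "y \<otimes> e' \<otimes> inv B' = e'"
    using invols_fixed_point [OF y _ _ m(1) ym, of "inv B'"] B' by auto
  note e'G = invols_carrier [OF e'(1)]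
  have ycj: "y = cj (e' \<otimes> g) B"
  proof -
    have "y \<otimes> e' = e' \<otimes> B'" using e' y B' e'G by (metis inv_solve_right' inv_closed m_closed)
    then have "y = cj e' B'" using y B' e'G unfolding cj_def by (metis inv_solve_right m_closed)
    then show ?thesis using B g e'G by (simp add: B'_def cj_cj)
  qed
  have By: "y \<otimes> B = B \<otimes> y"
    unfolding y_def using Bx B x by (metis group_commutes_pow)
  have h: "e' \<otimes> g \<in> carrier G" using e'G g by simp
  have "e' \<otimes> g \<otimes> (B \<otimes> B) = B \<otimes> B \<otimes> (e' \<otimes> g)"
    using By ycj B h by (intro commuting_conjugate) auto
  then have "cj (e' \<otimes> g) (B \<otimes> B) = B \<otimes> B" using B h by (simp add: cj_eq_iff_commute)
  then have yy: "y \<otimes> y = B \<otimes> B" using ycj B h by (simp add: cj_mult)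
  have pow_sq: "u [^] (m + 1) = (u \<otimes> u) [^] j" if "u \<in> carrier G" for u
    using nat_pow_pow [OF that, of 2 j] that unfolding j by (simp add: numeral_2_eq_2)
  have "y = y [^] (m + 1)" using ym y by simp
  also have "\<dots> = (y \<otimes> y) [^] j" using y by (rule pow_sq)
  also have "\<dots> = B [^] (m + 1)" using B yy pow_sq by simp
  also have "\<dots> = B" using m B by simp
  finally have "y = B" .
  then show ?thesis using py by (simp add: B'_def)
qed

text \<open>If \<open>B\<^sup>2\<close> commutes with \<open>e\<close>, then \<open>B\<close> centralises the commutator of \<open>B\<close> and \<open>e\<close>; so
  \<open>central_commutator\<close> allows a descent from \<open>B\<^bsup>2^k\<^esup> = 1\<close> to \<open>B\<close>.\<close>

lemma two_element_commutes_invols: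
  assumes "B \<in> carrier G" "B [^] (2 ^ k :: nat) = \<one>" "e \<in> invols"
  shows "B \<otimes> e = e \<otimes> B"
  using assms
proof (induction k arbitrary: B)
  case 0
  then show ?case using invols_carrier by simp
next
  case (Suc k)
  note eG = invols_carrier [OF \<open>e \<in> invols\<close>] and B = Suc.prems(1)
  have "(B \<otimes> B) [^] (2 ^ k :: nat) = \<one>"
    using Suc.prems nat_pow_pow [of B 2 "2 ^ k"] by (simp add: numeral_2_eq_2)
  then have BB: "B \<otimes> B \<otimes> e = e \<otimes> (B \<otimes> B)" using Suc by simp
  define c where "c = cj B e \<otimes> inv e"
  have c: "c \<in> invols"
    using B Suc.prems(3) cj_invols subgroup_invols unfolding c_def
    by (simp add: subgroup.m_closed subgroup.m_inv_closed)
  have "cj B c = cj B (cj B e) \<otimes> cj B e"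
    using B eG Suc.prems(3) by (simp add: c_def cj_mult invols_inv)
  also have "cj B (cj B e) = e" using BB B eG by (simp add: cj_cj cj_eq_iff_commute)
  also have "e \<otimes> cj B e = cj B e \<otimes> e" using Suc.prems(3) B cj_invols invols_comm by blast
  also have "\<dots> = c" using Suc.prems(3) by (simp add: c_def invols_inv)
  finally have "B \<otimes> c = c \<otimes> B" using B invols_carrier [OF c] by (simp add: cj_eq_iff_commute)
  moreover have "c \<otimes> e = e \<otimes> c" using c Suc.prems(3) invols_comm by blast
  ultimately have "c = \<one>" using central_commutator [OF B eG c_def] by simp
  then have "cj B e = e" using B eG unfolding c_def by (metis cj_closed inv_equality inv_inv inv_closed)
  then show ?case using B eG by (simp add: cj_eq_iff_commute)
qed

text \<open>The commutator of \<open>B\<close> and its conjugate \<open>B'\<close> lies in \<open>invols\<close>, so both of them centralise it. Hence they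
  commute, \<open>B'\<^sup>2 = B\<^sup>2\<close>, and the square of \<open>B' B\<inverse>\<close> is 1.\<close>

lemma even_rigid:
  assumes g: "g \<in> carrier G" and B: "B \<in> carrier G" and m: "B [^] (2 ^ k :: nat) = \<one>"
    and comm: "proj B \<otimes>\<^bsub>Q\<^esub> proj (cj g B) = proj (cj g B) \<otimes>\<^bsub>Q\<^esub> proj B"
  shows "proj (cj g B) = proj B"
proof -
  define B' where "B' = cj g B"
  have B': "B' \<in> carrier G" "B' [^] (2 ^ k :: nat) = \<one>"
    using g B m cj_pow [of g B "2 ^ k"] by (auto simp: B'_def)
  define c where "c = cj B B' \<otimes> inv B'"
  have c: "c \<in> invols" using comm proj_commute_iff [OF B B'(1)] by (simp add: c_def B'_def)
  have "c = \<one>"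
    using two_element_commutes_invols [OF B m c] two_element_commutes_invols [OF B' c]
    by (intro central_commutator [OF B B'(1) c_def]) auto
  then have "cj B B' = B'" using B B' unfolding c_def by (metis cj_closed inv_equality inv_inv inv_closed)
  then have BB': "B \<otimes> B' = B' \<otimes> B" using B B' by (simp add: cj_eq_iff_commute)
  then have "g \<otimes> (B \<otimes> B) = B \<otimes> B \<otimes> g"
    using g B by (intro commuting_conjugate) (auto simp: B'_def)
  then have "cj g (B \<otimes> B) = B \<otimes> B" using B g by (simp add: cj_eq_iff_commute)
  then have sq: "B' \<otimes> B' = B \<otimes> B" using B g by (simp add: cj_mult B'_def)
  have "inv B \<otimes> B' = B' \<otimes> inv B"
    using BB' B B' by (metis inv_closed inv_solve_left inv_solve_right m_assoc m_closed)
  then have "B' \<otimes> inv B \<otimes> (B' \<otimes> inv B) = B' \<otimes> B' \<otimes> (inv B \<otimes> inv B)"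
    using B B' by (metis inv_closed m_assoc m_closed)
  also have "\<dots> = \<one>" unfolding sq using B by (simp add: m_assoc)
  finally have "B' \<otimes> inv B \<in> invols" using B B' by (simp add: invols_def)
  then show ?thesis using proj_eq_iff B B' by (simp add: B'_def)
qed

text \<open>Commuting conjugates in the quotient coincide: by the two preceding lemmas this holds for their
  powers of odd order and of two-power order, and these powers determine an element.\<close>

lemma Q_abelian:
  assumes "x \<in> carrier Q" "y \<in> carrier Q"
  shows "x \<otimes>\<^bsub>Q\<^esub> y = y \<otimes>\<^bsub>Q\<^esub> x"
proof -
  have "finite (carrier Q)" using fin by (simp add: proj_surj)
  moreover have "Q.cj h z = z"
    if hz: "h \<in> carrier Q" "z \<in> carrier Q" and comm: "Q.cj h z \<otimes>\<^bsub>Q\<^esub> z = z \<otimes>\<^bsub>Q\<^esub> Q.cj h z" for h z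
  proof -
    obtain g B where g: "g \<in> carrier G" "h = proj g" and B: "B \<in> carrier G" "z = proj B"
      using hz by (auto simp: proj_surj)
    have pcj: "proj (cj g X) = Q.cj h (proj X)" if "X \<in> carrier G" for X
      using g that by (simp add: cj_def Q.cj_def)
    have pow: "Q.cj h (z [^]\<^bsub>Q\<^esub> n) = z [^]\<^bsub>Q\<^esub> n"
      if n: "(odd m \<and> (B [^] n) [^] m = \<one>) \<or> (B [^] n) [^] (2 ^ k :: nat) = \<one>" for n m k :: nat
    proof -
      have Bn: "B [^] n \<in> carrier G" "proj (B [^] n) = z [^]\<^bsub>Q\<^esub> n"
        using B by (simp_all add: proj.hom_nat_pow)
      have "z [^]\<^bsub>Q\<^esub> n \<otimes>\<^bsub>Q\<^esub> Q.cj h z [^]\<^bsub>Q\<^esub> n = Q.cj h z [^]\<^bsub>Q\<^esub> n \<otimes>\<^bsub>Q\<^esub> z [^]\<^bsub>Q\<^esub> n"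
        using comm hz by (metis Q.cj_closed Q.group_commutes_pow Q.nat_pow_closed)
      then have "proj (B [^] n) \<otimes>\<^bsub>Q\<^esub> proj (cj g (B [^] n)) = proj (cj g (B [^] n)) \<otimes>\<^bsub>Q\<^esub> proj (B [^] n)"
        using Bn hz by (simp add: pcj Q.cj_pow)
      then have "proj (cj g (B [^] n)) = proj (B [^] n)"
        using n odd_rigid [OF g(1) Bn(1)] even_rigid [OF g(1) Bn(1)] by blast
      then show ?thesis using Bn by (simp add: pcj)
    qed
    have ord: "order G > 0" using fin by (simp add: order_gt_0_iff_finite)
    obtain k m where km: "order G = 2 ^ k * m" "odd m"
      using two_power_times_odd [OF ord] by blast
    have Bo: "B [^] (2 ^ k * m) = \<one>" using pow_order_eq_1 [OF B(1)] km by simp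
    have fix2k: "Q.cj h z [^]\<^bsub>Q\<^esub> (2 ^ k :: nat) = z [^]\<^bsub>Q\<^esub> (2 ^ k :: nat)"
      using pow [of m "2 ^ k" 0] km Bo B hz by (simp add: nat_pow_pow Q.cj_pow)
    have fixm: "Q.cj h z [^]\<^bsub>Q\<^esub> m = z [^]\<^bsub>Q\<^esub> m"
      using pow [of 0 m k] km Bo B hz by (simp add: nat_pow_pow Q.cj_pow mult.commute)
    let ?t = "Q.cj h z \<otimes>\<^bsub>Q\<^esub> inv\<^bsub>Q\<^esub> z"
    have t: "?t \<in> carrier Q" using hz by simp
    have com': "Q.cj h z \<otimes>\<^bsub>Q\<^esub> inv\<^bsub>Q\<^esub> z = inv\<^bsub>Q\<^esub> z \<otimes>\<^bsub>Q\<^esub> Q.cj h z"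
      using comm hz by (metis Q.cj_closed Q.inv_closed Q.inv_solve_left Q.inv_solve_right Q.m_assoc Q.m_closed)
    have tp: "?t [^]\<^bsub>Q\<^esub> n = \<one>\<^bsub>Q\<^esub>" if "Q.cj h z [^]\<^bsub>Q\<^esub> n = z [^]\<^bsub>Q\<^esub> n" for n :: nat
      using that hz com' by (simp add: Q.pow_mult_distrib Q.nat_pow_inv)
    have "Q.ord ?t dvd 2 ^ k" "Q.ord ?t dvd m"
      using tp fix2k fixm t Q.pow_eq_id by blast+
    moreover have "coprime (2 ^ k) m" using km by simp
    ultimately have "Q.ord ?t = 1" using coprime_common_divisor_nat by blast
    then have "?t = \<one>\<^bsub>Q\<^esub>" using t Q.pow_eq_id [OF t, of 1] by simp
    then show ?thesis
      using hz by (metis Q.cj_closed Q.inv_closed Q.inv_equality Q.inv_inv)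
  qed
  ultimately show ?thesis
    using Q.abelian_if_commuting_conjugates_equal [OF _ _ Q.subgroup_self] assms by blast
qed

theorem commutator_involution:
  assumes "x \<in> carrier G" "y \<in> carrier G"
  shows "cj x y \<otimes> inv y \<in> invols"
  using assms Q_abelian [of "proj x" "proj y"] proj_commute_iff by (simp add: proj_surj)

end

section \<open>Eigenvectors in invariant subspaces\<close>

lemma norm_vector_scale: "norm (c *s v) = norm c * norm v" for v :: "complex ^ 'n"
  by (simp add: norm_vec_def norm_mult L2_set_right_distrib)

lemma norm_matrix_vector_le: "norm (A *v v) \<le> norm A * norm v" for A :: "complex ^ 'n ^ 'm"
proof -
  have "norm ((A *v v) $ i) \<le> norm (A $ i) * norm v" for i
  proof -
    have "norm ((A *v v) $ i) \<le> (\<Sum>j\<in>UNIV. norm (A $ i $ j) * norm (v $ j))"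
      unfolding matrix_vector_mult_def by (simp add: norm_mult [symmetric] norm_sum)
    also have "\<dots> \<le> norm (A $ i) * norm v"
      using L2_set_mult_ineq [of "\<lambda>j. norm (A $ i $ j)" "\<lambda>j. norm (v $ j)" UNIV]
      by (simp add: norm_vec_def)
    finally show ?thesis .
  qed
  then have "norm (A *v v) \<le> L2_set (\<lambda>i. norm (A $ i) * norm v) UNIV"
    unfolding norm_vec_def [of "A *v v"] by (intro L2_set_mono) auto
  also have "\<dots> = norm A * norm v"
    by (simp add: norm_vec_def [of A] L2_set_left_distrib)
  finally show ?thesis .
qed

lemma mat_scale_vector: "mat c *v v = c *s v" for v :: "'a::comm_semiring_1 ^ 'n"
proof -
  have "(\<Sum>j\<in>UNIV. mat c $ i $ j * v $ j) = (\<Sum>j\<in>UNIV. if j = i then c * v $ j else 0)" for i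
    by (intro sum.cong) (auto simp: mat_def)
  then show ?thesis by (simp add: vec_eq_iff matrix_vector_mult_def)
qed

text \<open>This is \<open>p(A) v\<close>, by the Horner scheme.\<close>

definition horner_vec :: "complex ^ 'n ^ 'n \<Rightarrow> complex ^ 'n \<Rightarrow> complex poly \<Rightarrow> complex ^ 'n" where
  "horner_vec A v p = fold_coeffs (\<lambda>a w. a *s v + A *v w) p 0"

lemma horner_vec_0 [simp]: "horner_vec A v 0 = 0"
  by (simp add: horner_vec_def)

lemma horner_vec_pCons [simp]: "horner_vec A v (pCons a p) = a *s v + A *v horner_vec A v p"
  by (cases "p = 0 \<and> a = 0") (auto simp: horner_vec_def)

lemma horner_vec_add: "horner_vec A v (p + q) = horner_vec A v p + horner_vec A v q"
proof (induction p arbitrary: q)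
  case 0 then show ?case by simp
next
  case (pCons a p)
  obtain b q' where "q = pCons b q'" by (cases q)
  then show ?case
    by (simp add: pCons.IH vec.scale_left_distrib matrix_vector_right_distrib)
qed

lemma horner_vec_smult: "horner_vec A v (Polynomial.smult c p) = c *s horner_vec A v p"
  by (induction p) (simp_all add: vec.scale_right_distrib vec.scale)

lemma horner_vec_sum: "horner_vec A v (\<Sum>i\<in>I. f i) = (\<Sum>i\<in>I. horner_vec A v (f i))"
  by (induction I rule: infinite_finite_induct) (simp_all add: horner_vec_add)

lemma horner_vec_in_subspace:
  assumes "vec.subspace W" "\<And>w. w \<in> W \<Longrightarrow> A *v w \<in> W" "v \<in> W"
  shows "horner_vec A v p \<in> W"
  using assms by (induction p) (auto simp: vec.subspace_0 vec.subspace_add vec.subspace_scale)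

lemma annihilating_poly:
  obtains p where "p \<noteq> 0" "horner_vec A v p = 0"
proof -
  define b where "b i = horner_vec A v (Polynomial.monom 1 i)" for i
  have lin: "horner_vec A v (\<Sum>i\<in>I. Polynomial.monom (a i) i) = (\<Sum>i\<in>I. a i *s b i)" for a I
  proof -
    have "Polynomial.monom (a i) i = Polynomial.smult (a i) (Polynomial.monom 1 i)" for i by (simp add: smult_monom)
    then show ?thesis by (simp add: horner_vec_sum b_def horner_vec_smult)
  qed
  show ?thesis
  proof (cases "inj_on b {..CARD('a)}")
    case False
    then obtain i j where ij: "i \<noteq> j" "b i = b j" by (auto simp: inj_on_def)
    have "horner_vec A v (Polynomial.monom 1 i + Polynomial.smult (-1) (Polynomial.monom 1 j)) = 0"
      using ij(2) unfolding horner_vec_add horner_vec_smult b_def by simp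
    moreover have "Polynomial.coeff (Polynomial.monom 1 i + Polynomial.smult (-1) (Polynomial.monom 1 j)) i \<noteq> (0::complex)" using ij by simp
    then have "Polynomial.monom 1 i + Polynomial.smult (-1) (Polynomial.monom 1 j) \<noteq> (0::complex poly)" by (metis coeff_0)
    ultimately show ?thesis using that by blast
  next
    case True
    have "vec.dependent (b ` {..CARD('a)})"
    proof (rule ccontr)
      assume "\<not> ?thesis"
      then have "card (b ` {..CARD('a)}) \<le> vec.dim (UNIV :: (complex ^ 'a) set)"
        by (intro vec.independent_card_le_dim) auto
      then show False using True by (simp add: card_image card_cart_basis)
    qed
    then obtain u w where u: "w \<in> b ` {..CARD('a)}" "u w \<noteq> 0"
      "(\<Sum>w\<in>b ` {..CARD('a)}. u w *s w) = 0"
      by (auto simp: vec.dependent_finite)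
    obtain k where k: "k \<le> CARD('a)" "w = b k" using u(1) by auto
    let ?p = "\<Sum>i\<in>{..CARD('a)}. Polynomial.monom (u (b i)) i"
    have "Polynomial.coeff ?p k = u (b k)"
      using k by (simp add: coeff_sum)
    then have "?p \<noteq> 0" using u k by (metis coeff_0)
    moreover have "horner_vec A v ?p = 0"
      using u(3) True by (simp add: lin sum.reindex)
    ultimately show ?thesis using that by blast
  qed
qed

text \<open>Take a polynomial that annihilates a vector of \<open>W\<close>. Splitting off linear factors one at a time
  must at some stage turn a nonzero vector of \<open>W\<close> into 0, and that vector is an eigenvector.\<close>

lemma eigenvector_in_invariant_subspace:
  fixes A :: "complex ^ 'n ^ 'n"
  assumes W: "vec.subspace W" "W \<noteq> {0}" and inv: "\<And>w. w \<in> W \<Longrightarrow> A *v w \<in> W"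
  shows "\<exists>c v. v \<in> W \<and> v \<noteq> 0 \<and> A *v v = c *s v"
proof -
  obtain v where v: "v \<in> W" "v \<noteq> 0" using W vec.subspace_0 by blast
  have "\<exists>c w. w \<in> W \<and> w \<noteq> 0 \<and> A *v w = c *s w" if "p \<noteq> 0" "horner_vec A v p = 0" for p
    using that
  proof (induction "degree p" arbitrary: p rule: less_induct)
    case less
    show ?case
    proof (cases "degree p = 0")
      case True
      then obtain a where "p = [:a:]" by (rule degree_eq_zeroE)
      then show ?thesis using less v by simp
    next
      case False
      then obtain c where "poly p c = 0"
        using alg_closed_imp_poly_has_root [of p] by auto
      then obtain q where q: "p = [:-c, 1:] * q" by (metis dvdE poly_eq_0_iff_dvd)
      then have "q \<noteq> 0" using less by auto
      then have deg: "degree q < degree p" unfolding q by (subst degree_mult_eq) auto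
      have pq: "p = Polynomial.smult (-c) q + pCons 0 q" by (simp add: q)
      have "horner_vec A v p = - (c *s horner_vec A v q) + A *v horner_vec A v q"
        unfolding pq horner_vec_add horner_vec_smult by simp
      then have eig: "A *v horner_vec A v q = c *s horner_vec A v q"
        using less.prems(2) by simp
      show ?thesis
      proof (cases "horner_vec A v q = 0")
        case True
        then show ?thesis using less.hyps [OF deg \<open>q \<noteq> 0\<close>] by blast
      next
        case False
        then show ?thesis using eig horner_vec_in_subspace [OF W(1) inv v(1)] by blast
      qed
    qed
  qed
  moreover obtain p where "p \<noteq> 0" "horner_vec A v p = 0" by (rule annihilating_poly)
  ultimately show ?thesis by blast
qed

lemma subspace_eigenspace:
  fixes A :: "'a::field ^ 'n ^ 'n"
  assumes "vec.subspace W"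
  shows "vec.subspace {v \<in> W. A *v v = c *s v}"
proof (rule vec.subspaceI)
  show "0 \<in> {v \<in> W. A *v v = c *s v}" using assms by (simp add: vec.subspace_0)
  show "x + y \<in> {v \<in> W. A *v v = c *s v}"
    if "x \<in> {v \<in> W. A *v v = c *s v}" "y \<in> {v \<in> W. A *v v = c *s v}" for x y
    using that assms by (simp add: vec.subspace_add matrix_vector_right_distrib vec.scale_right_distrib)
  show "a *s x \<in> {v \<in> W. A *v v = c *s v}" if "x \<in> {v \<in> W. A *v v = c *s v}" for a x
    using that assms by (simp add: vec.subspace_scale vec.scale mult.commute)
qed

text \<open>On an invariant subspace of least dimension every member of \<open>F\<close> is scalar, since its eigenspaces
  there are invariant under \<open>F\<close>.\<close>

lemma common_eigenvector:
  fixes F :: "(complex ^ 'n ^ 'n) set"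
  assumes W: "vec.subspace W" "W \<noteq> {0}"
    and inv: "\<And>A w. A \<in> F \<Longrightarrow> w \<in> W \<Longrightarrow> A *v w \<in> W"
    and comm: "\<And>A B w. A \<in> F \<Longrightarrow> B \<in> F \<Longrightarrow> w \<in> W \<Longrightarrow> A *v (B *v w) = B *v (A *v w)"
  shows "\<exists>v\<in>W. v \<noteq> 0 \<and> (\<forall>A\<in>F. \<exists>c. A *v v = c *s v)"
proof -
  define P where "P U \<longleftrightarrow> vec.subspace U \<and> U \<noteq> {0} \<and> U \<subseteq> W \<and> (\<forall>A\<in>F. \<forall>w\<in>U. A *v w \<in> U)" for U
  have "P W" using W inv by (auto simp: P_def)
  then have "\<exists>U. P U \<and> (\<forall>U'. P U' \<longrightarrow> vec.dim U \<le> vec.dim U')" by (rule ex_has_least_nat)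
  then obtain U where U: "P U" and "\<forall>U'. P U' \<longrightarrow> vec.dim U \<le> vec.dim U'" by (elim exE conjE)
  then have min: "vec.dim U \<le> vec.dim U'" if "P U'" for U' using that by simp
  have "vec.subspace U" "U \<noteq> {0}" using U by (simp_all add: P_def)
  moreover have "0 \<in> U" using \<open>vec.subspace U\<close> by (rule vec.subspace_0)
  ultimately obtain v where v: "v \<in> U" "v \<noteq> 0" by blast
  have eig: "\<exists>c. A *v v = c *s v" if A: "A \<in> F" for A
  proof -
    obtain c u where u: "u \<in> U" "u \<noteq> 0" "A *v u = c *s u"
      using eigenvector_in_invariant_subspace [of U A] U A unfolding P_def by auto
    let ?U = "{v \<in> U. A *v v = c *s v}"
    have sub: "vec.subspace ?U" using U by (intro subspace_eigenspace) (simp add: P_def)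
    have "B *v w \<in> ?U" if "B \<in> F" "w \<in> ?U" for B w
      using that U A comm [OF A \<open>B \<in> F\<close>, of w] by (auto simp: P_def vec.scale)
    moreover have "?U \<noteq> {0}" "?U \<subseteq> W" using u U by (auto simp: P_def)
    ultimately have "P ?U" using sub by (simp add: P_def)
    then have "vec.dim U \<le> vec.dim ?U" by (rule min)
    moreover have "vec.subspace U" using U by (simp add: P_def)
    ultimately have "?U = U" using sub by (intro vec.subspace_dim_equal) auto
    then show ?thesis using v by blast
  qed
  have "v \<in> W" using v(1) U by (auto simp: P_def)
  then show ?thesis using v(2) eig by blast
qed

text \<open>Schur's lemma.\<close>

lemma commuting_with_irreducible_is_scalar:
  fixes G :: "(complex ^ 'n ^ 'n) set"
  assumes irr: "irreducible_matrices G" and comm: "\<And>A. A \<in> G \<Longrightarrow> X ** A = A ** X"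
  obtains c where "X = mat c"
proof -
  have nt: "(UNIV :: (complex ^ 'n) set) \<noteq> {0}"
  proof -
    have "(axis undefined 1 :: complex ^ 'n) \<noteq> 0" by (simp add: axis_eq_0_iff)
    then show ?thesis by blast
  qed
  obtain c v where v: "v \<noteq> 0" "X *v v = c *s v"
    using eigenvector_in_invariant_subspace [OF vec.subspace_UNIV nt, of X] by auto
  let ?W = "{v \<in> UNIV. X *v v = c *s v}"
  have "A *v w \<in> ?W" if "A \<in> G" "w \<in> ?W" for A w
  proof -
    have "X *v (A *v w) = A *v (X *v w)"
      by (simp add: matrix_vector_mul_assoc comm [OF \<open>A \<in> G\<close>])
    then show ?thesis using that by (simp add: vec.scale)
  qed
  moreover have "vec.subspace ?W" by (intro subspace_eigenspace vec.subspace_UNIV)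
  ultimately have "?W = {0} \<or> ?W = UNIV"
    using irr unfolding irreducible_matrices_def by blast
  then have "?W = UNIV" using v by blast
  then have "X *v w = mat c *v w" for w unfolding mat_scale_vector by blast
  then have "X = mat c" by (simp add: matrix_eq)
  then show ?thesis by (rule that)
qed

section \<open>Matrix norms and limits of spectra\<close>

text \<open>The norm of a matrix is its Frobenius norm, whose square is the sum of the squared norms of the columns.\<close>

lemma norm_matrix_mult_le: "norm (A ** B) \<le> norm A * norm B"
  for A :: "complex ^ 'n ^ 'm" and B :: "complex ^ 'p ^ 'n"
proof -
  have sq: "norm X ^ 2 = (\<Sum>j\<in>UNIV. norm (column j X) ^ 2)" for X :: "complex ^ 'r ^ 's"
  proof -
    have "norm X ^ 2 = (\<Sum>i\<in>UNIV. \<Sum>j\<in>UNIV. norm (X $ i $ j) ^ 2)"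
      by (simp add: norm_vec_def L2_set_def sum_nonneg)
    also have "\<dots> = (\<Sum>j\<in>UNIV. \<Sum>i\<in>UNIV. norm (X $ i $ j) ^ 2)" by (rule sum.swap)
    finally show ?thesis by (simp add: norm_vec_def L2_set_def sum_nonneg column_def)
  qed
  have col: "column j (A ** B) = A *v column j B" for j
    by (simp add: column_def matrix_matrix_mult_def matrix_vector_mult_def vec_eq_iff)
  have "norm (A ** B) ^ 2 = (\<Sum>j\<in>UNIV. norm (A *v column j B) ^ 2)"
    by (simp add: sq [of "A ** B"] col)
  also have "\<dots> \<le> (\<Sum>j\<in>UNIV. (norm A * norm (column j B)) ^ 2)"
    by (intro sum_mono power_mono norm_matrix_vector_le) auto
  also have "\<dots> = (norm A * norm B) ^ 2"
    by (simp add: power_mult_distrib sq [of B] sum_distrib_left)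
  finally show ?thesis by (rule power2_le_imp_le) simp
qed

lemma bounded_bilinear_matrix_mult:
  "bounded_bilinear ((**) :: complex ^ 'n ^ 'm \<Rightarrow> complex ^ 'p ^ 'n \<Rightarrow> complex ^ 'p ^ 'm)"
proof
  fix A A' :: "complex ^ 'n ^ 'm" and B B' :: "complex ^ 'p ^ 'n" and r :: real
  show "(A + A') ** B = A ** B + A' ** B"
    by (simp add: matrix_matrix_mult_def vec_eq_iff sum.distrib algebra_simps)
  show "A ** (B + B') = A ** B + A ** B'"
    by (simp add: matrix_matrix_mult_def vec_eq_iff sum.distrib algebra_simps)
  show "(r *\<^sub>R A) ** B = r *\<^sub>R (A ** B)"
    by (simp add: matrix_matrix_mult_def vec_eq_iff scaleR_sum_right)
  show "A ** (r *\<^sub>R B) = r *\<^sub>R (A ** B)"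
    by (simp add: matrix_matrix_mult_def vec_eq_iff scaleR_sum_right)
  show "\<exists>K. \<forall>(A :: complex ^ 'n ^ 'm) (B :: complex ^ 'p ^ 'n). norm (A ** B) \<le> norm A * norm B * K"
    by (intro exI [of _ 1]) (simp add: norm_matrix_mult_le)
qed

lemma scaleR_conv_scale: "r *\<^sub>R v = of_real r *s v" for v :: "complex ^ 'n"
  by (simp only: vec_eq_iff vector_scaleR_component vector_smult_component
      scaleR_conv_of_real [where 'a = complex] simp_thms)

lemma scaleR_matrix_vector: "(r *\<^sub>R A) *v v = r *\<^sub>R (A *v v)" for A :: "complex ^ 'n ^ 'm"
  by (simp add: matrix_vector_mult_def vec_eq_iff scaleR_sum_right)

definition smul :: "'a::comm_ring_1 \<Rightarrow> 'a ^ 'n ^ 'm \<Rightarrow> 'a ^ 'n ^ 'm" where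
  "smul c A = (\<chi> i j. c * A $ i $ j)"

lemma smul_mult [simp]: "smul c A ** B = smul c (A ** B)" "A ** smul c B = smul c (A ** B)"
  by (simp_all add: smul_def matrix_matrix_mult_def vec_eq_iff sum_distrib_left mult_ac)

lemma smul_smul [simp]: "smul c (smul d A) = smul (c * d) A"
  by (simp add: smul_def vec_eq_iff mult_ac)

lemma smul_1 [simp]: "smul 1 A = A"
  by (simp add: smul_def vec_eq_iff)

lemma smul_left_cancel: "c \<noteq> 0 \<Longrightarrow> smul c A = smul c B \<longleftrightarrow> A = B" for c :: "'a::field"
  by (simp add: smul_def vec_eq_iff)

lemma mat_eq_smul: "mat c = smul c (mat 1)"
  by (simp add: smul_def mat_def vec_eq_iff)

lemma det_smul: "det (smul c A) = c ^ CARD('n) * det A" for A :: "'a::field ^ 'n ^ 'n"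
proof -
  have "det (smul c (mat 1 :: 'a ^ 'n ^ 'n)) = c ^ CARD('n)"
    by (subst det_diagonal) (simp_all add: smul_def mat_def)
  then show ?thesis using det_mul [of "smul c (mat 1)" A] by simp
qed

lemma spectrum_iff_det: "z \<in> spectrum A \<longleftrightarrow> det (A - mat z) = 0" for A :: "'a::field ^ 'n ^ 'n"
proof -
  have "z \<in> spectrum A \<longleftrightarrow> (\<exists>v. v \<noteq> 0 \<and> (A - mat z) *v v = 0)"
    by (simp add: spectrum_def matrix_vector_mult_diff_rdistrib mat_scale_vector)
  also have "\<dots> \<longleftrightarrow> \<not> invertible (A - mat z)"
    unfolding invertible_left_inverse matrix_left_invertible_ker by blast
  also have "\<dots> \<longleftrightarrow> det (A - mat z) = 0" by (simp add: invertible_det_nz)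
  finally show ?thesis .
qed

lemma spectrum_bound: "z \<in> spectrum A \<Longrightarrow> norm z \<le> norm A" for A :: "complex ^ 'n ^ 'n"
proof -
  assume "z \<in> spectrum A"
  then obtain v where v: "v \<noteq> 0" "A *v v = z *s v" by (auto simp: spectrum_def)
  have "norm z * norm v \<le> norm A * norm v"
    using norm_matrix_vector_le [of A v] by (simp add: v norm_vector_scale)
  then show ?thesis using v by simp
qed

lemma continuous_on_char_det:
  "continuous_on S (\<lambda>p. det (fst p - mat (snd p)))" for S :: "((complex ^ 'n ^ 'n) \<times> complex) set"
proof -
  have "continuous_on S (\<lambda>p. (fst p - mat (snd p)) $ i $ j)" for i j
    by (cases "i = j") (auto simp: mat_def intro!: continuous_intros)
  then show ?thesis unfolding det_def
    by (intro continuous_on_sum continuous_on_mult continuous_on_prod continuous_on_const)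
qed

lemma holomorphic_char_det: "(\<lambda>z. det (A - mat z)) holomorphic_on S" for A :: "complex ^ 'n ^ 'n"
proof -
  have "(\<lambda>z. (A - mat z) $ i $ j) holomorphic_on S" for i j
    by (cases "i = j") (auto simp: mat_def intro!: holomorphic_intros)
  then show ?thesis unfolding det_def by (intro holomorphic_intros) auto
qed

text \<open>Apply Hurwitz's theorem to the characteristic polynomials. The point \<open>z0\<close>, too large to be an
  eigenvalue of \<open>N\<close>, only serves to make the limit nonconstant on \<open>S\<close>.\<close>

lemma spectrum_limit_avoids:
  fixes C :: "nat \<Rightarrow> complex ^ 'n ^ 'n"
  assumes lim: "C \<longlonglongrightarrow> N" and S: "open S" "connected S"
    and avoid: "\<And>k. spectrum (C k) \<inter> S = {}"
    and z0: "z0 \<in> S" "norm z0 > norm N"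
  shows "spectrum N \<inter> S = {}"
proof -
  have "det (N - mat z) \<noteq> 0" if z: "z \<in> S" for z
  proof
    assume z_root: "det (N - mat z) = 0"
    have "det (N - mat z) \<noteq> 0"
    proof (rule Hurwitz_no_zeros [OF S, where \<F> = "\<lambda>k z. det (C k - mat z)"
          and g = "\<lambda>z. det (N - mat z)" and ?z0.0 = z])
      show "(\<lambda>z. det (C k - mat z)) holomorphic_on S" for k by (rule holomorphic_char_det)
      show "(\<lambda>z. det (N - mat z)) holomorphic_on S" by (rule holomorphic_char_det)
      show "det (C k - mat w) \<noteq> 0" if "w \<in> S" for k w
        using avoid [of k] that spectrum_iff_det by blast
      show "\<not> (\<lambda>z. det (N - mat z)) constant_on S"
      proof
        assume "(\<lambda>z. det (N - mat z)) constant_on S"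
        then have "det (N - mat z0) = 0" using z z0 z_root by (metis constant_on_def)
        then show False using z0 spectrum_bound [of z0 N] by (simp add: spectrum_iff_det)
      qed
      show "z \<in> S" by (rule z)
      show "uniform_limit K (\<lambda>k z. det (C k - mat z)) (\<lambda>z. det (N - mat z)) sequentially"
        if K: "compact K" and "K \<subseteq> S" for K
      proof -
        let ?R = "cball N 1 \<times> K"
        have comp: "compact ?R" using K by (intro compact_Times) auto
        have uc: "uniformly_continuous_on ?R (\<lambda>p. det (fst p - mat (snd p)))"
          using comp continuous_on_char_det by (rule compact_uniformly_continuous [rotated])
        have ul: "uniform_limit K (\<lambda>k z. (C k, z)) (\<lambda>z. (N, z)) sequentially"
        proof (rule uniform_limitI)
          fix e :: real assume "e > 0"
          then have "\<forall>\<^sub>F k in sequentially. dist (C k) N < e" using lim by (rule tendstoD [rotated])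
          then show "\<forall>\<^sub>F k in sequentially. \<forall>z\<in>K. dist (C k, z) (N, z) < e"
            by (simp add: dist_Pair_Pair)
        qed
        have ev: "\<forall>\<^sub>F k in sequentially. \<forall>z\<in>K. (C k, z) \<in> ?R"
          using tendstoD [OF lim, of 1] by (rule eventually_mono) (auto simp: dist_commute)
        show ?thesis
          using uniform_limit_compose_uniformly_continuous_on [OF ul uc ev compact_imp_closed [OF comp]]
          by simp
      qed
    qed
    then show False using z_root by simp
  qed
  then show ?thesis using spectrum_iff_det by blast
qed

lemma real_spectrum_limit:
  fixes C :: "nat \<Rightarrow> complex ^ 'n ^ 'n"
  assumes lim: "C \<longlonglongrightarrow> N" and real: "\<And>k. spectrum (C k) \<subseteq> \<real>"
  shows "spectrum N \<subseteq> \<real>"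
proof -
  (* A point of the imaginary axis outside the disc that contains the spectrum of N. *)
  let ?z = "of_real (norm N + 1) * \<i>"
  have nz: "norm ?z = norm N + 1" by (simp add: norm_mult)
  have im: "Im z = 0" if "z \<in> spectrum (C k)" for z k
    using real [of k] that by (auto simp: complex_is_Real_iff)
  have "spectrum N \<inter> {z. Im z > 0} = {}"
    using lim by (rule spectrum_limit_avoids [where ?z0.0 = ?z])
      (use im nz in \<open>auto simp: open_halfspace_Im_gt add_nonneg_pos\<close>)
  moreover have "spectrum N \<inter> {z. Im z < 0} = {}"
    using lim by (rule spectrum_limit_avoids [where ?z0.0 = "-?z"])
      (use im nz in \<open>auto simp: open_halfspace_Im_lt add_nonneg_pos norm_minus_cancel simp del: minus_mult_left minus_add_distrib\<close>)
  ultimately show ?thesis by (force simp: complex_is_Real_iff)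
qed

lemma spectrum_scaleR_real:
  fixes A :: "complex ^ 'n ^ 'n"
  assumes "spectrum A \<subseteq> \<real>" "r \<noteq> 0"
  shows "spectrum (r *\<^sub>R A) \<subseteq> \<real>"
proof
  fix c assume "c \<in> spectrum (r *\<^sub>R A)"
  then obtain v where v: "v \<noteq> 0" "(r *\<^sub>R A) *v v = c *s v" by (auto simp: spectrum_def)
  have "A *v v = inverse r *\<^sub>R ((r *\<^sub>R A) *v v)"
    using assms by (simp add: scaleR_matrix_vector)
  also have "\<dots> = (of_real (inverse r) * c) *s v"
    by (simp only: v scaleR_conv_scale vec.scale_scale)
  finally have "of_real (inverse r) * c \<in> \<real>" using assms v by (auto simp: spectrum_def)
  then have "of_real r * (of_real (inverse r) * c) \<in> \<real>" by (rule Reals_mult [OF Reals_of_real])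
  moreover have "of_real r * (of_real (inverse r) * c) = c" using assms by simp
  ultimately show "c \<in> \<real>" by (simp only:)
qed

section \<open>Compact groups whose ring commutators have real spectra\<close>

lemma matrix_inv_mult:
  assumes "invertible A"
  shows "A ** matrix_inv A = mat 1" "matrix_inv A ** A = mat 1"
  using someI_ex [OF assms [unfolded invertible_def]] unfolding matrix_inv_def by blast+

text \<open>Equal imaginary parts on the unit circle mean \<open>b' = b\<close> or \<open>b' = - cnj b\<close>; in the second case the
  squares have equal imaginary parts only if \<open>b\<close> is real or imaginary.\<close>

lemma unimodular_dichotomy:
  fixes b b' :: complex
  assumes "norm b = 1" "norm b' = 1" "b' - b \<in> \<real>" "b'\<^sup>2 - b\<^sup>2 \<in> \<real>"
  shows "b' = b \<or> (b = 1 \<or> b = -1) \<and> b' = -b"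
proof -
  have im: "Im b' = Im b" using assms(3) by (simp add: complex_is_Real_iff)
  have "(Re b')\<^sup>2 + (Im b')\<^sup>2 = 1" "(Re b)\<^sup>2 + (Im b)\<^sup>2 = 1"
    using assms(1,2) by (simp_all add: cmod_def)
  then have "(Re b')\<^sup>2 = (Re b)\<^sup>2" using im by simp
  then consider "Re b' = Re b" | "Re b' = - Re b" by (auto simp: power2_eq_iff)
  then show ?thesis
  proof cases
    case 1 then show ?thesis using im by (simp add: complex_eq_iff)
  next
    case 2
    have "Re b * Im b = 0" using assms(4) 2 im by (auto simp: complex_is_Real_iff power2_eq_square)
    then have "Re b = 0 \<or> Im b = 0" by auto
    then show ?thesis
    proof
      assume "Re b = 0" then show ?thesis using 2 im by (simp add: complex_eq_iff)
    next
      assume im0: "Im b = 0"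
      then have "(Re b)\<^sup>2 = 1" using \<open>(Re b)\<^sup>2 + (Im b)\<^sup>2 = 1\<close> by simp
      then have "Re b = 1 \<or> Re b = -1" by (simp add: power2_eq_1_iff)
      then show ?thesis using 2 im im0 by (auto simp: complex_eq_iff)
    qed
  qed
qed

locale compact_commutator_group =
  fixes G :: "(complex ^ 'n ^ 'n) set"
  assumes grp: "matrix_group G" and cpt: "compact G"
    and real_spec: "\<forall>A\<in>G. \<forall>B\<in>G. spectrum (ring_commutator A B) \<subseteq> \<real>"
begin

lemma one_in [simp]: "mat 1 \<in> G" and mult_in [simp]: "A \<in> G \<Longrightarrow> B \<in> G \<Longrightarrow> A ** B \<in> G"
  and inv_in [simp]: "A \<in> G \<Longrightarrow> matrix_inv A \<in> G"
  using grp by (auto simp: matrix_group_def)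

lemma inv_mult [simp]:
  assumes "A \<in> G"
  shows "A ** matrix_inv A = mat 1" "matrix_inv A ** A = mat 1"
    "X ** A ** matrix_inv A = X" "X ** matrix_inv A ** A = X"
  using matrix_inv_mult [of A] grp assms
  by (auto simp: matrix_group_def matrix_mul_assoc [symmetric])

lemma inv_vec [simp]:
  assumes "A \<in> G"
  shows "A *v (matrix_inv A *v v) = v" "matrix_inv A *v (A *v v) = v"
  using assms by (simp_all add: matrix_vector_mul_assoc)

lemma mult_eq_0 [simp]: "A \<in> G \<Longrightarrow> A *v v = 0 \<longleftrightarrow> v = 0"
  by (metis inv_vec(2) matrix_vector_mult_0_right)

text \<open>An invariant norm takes the place of an invariant inner product: the group acts by isometries of
  \<open>gnorm\<close>.\<close>

definition gnorm :: "complex ^ 'n \<Rightarrow> real" where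
  "gnorm v = (SUP A\<in>G. norm (A *v v))"

lemma norm_bound: obtains R where "R > 0" "\<And>A. A \<in> G \<Longrightarrow> norm A \<le> R"
proof -
  obtain R where "\<forall>A\<in>G. norm A \<le> R" using compact_imp_bounded [OF cpt] by (auto simp: bounded_iff)
  then show ?thesis using that [of "\<bar>R\<bar> + 1"] by force
qed

lemma bdd: "bdd_above ((\<lambda>A. norm (A *v v)) ` G)"
proof -
  obtain R where "\<And>A. A \<in> G \<Longrightarrow> norm A \<le> R" using norm_bound by blast
  then have "norm (A *v v) \<le> R * norm v" if "A \<in> G" for A
    using that norm_matrix_vector_le [of A v] mult_right_mono [of "norm A" R "norm v"] by force
  then show ?thesis by (auto simp: bdd_above_def)
qed

lemma norm_le_gnorm: "norm v \<le> gnorm v"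
  unfolding gnorm_def using cSUP_upper [OF one_in bdd, of v] by simp

lemma gnorm_bound: obtains R where "R > 0" "\<And>v. gnorm v \<le> R * norm v"
proof -
  obtain R where R: "R > 0" "\<And>A. A \<in> G \<Longrightarrow> norm A \<le> R" using norm_bound by blast
  have "gnorm v \<le> R * norm v" for v
    unfolding gnorm_def
  proof (rule cSUP_least)
    show "G \<noteq> {}" using one_in by blast
    show "norm (A *v v) \<le> R * norm v" if "A \<in> G" for A
      using R(2) [OF that] norm_matrix_vector_le [of A v] mult_right_mono [of "norm A" R "norm v"] by force
  qed
  then show ?thesis using that R by blast
qed

lemma gnorm_invariant [simp]:
  assumes "B \<in> G" shows "gnorm (B *v v) = gnorm v"
proof -
  have "(\<lambda>A. norm (A *v (B *v v))) ` G = (\<lambda>A. norm (A *v v)) ` ((\<lambda>A. A ** B) ` G)"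
    by (simp add: image_image matrix_vector_mul_assoc)
  also have "(\<lambda>A. A ** B) ` G = G"
  proof -
    have "A \<in> (\<lambda>A. A ** B) ` G" if "A \<in> G" for A
      using assms that by (intro rev_image_eqI [of "A ** matrix_inv B"]) auto
    then show ?thesis using assms by auto
  qed
  finally show ?thesis by (simp add: gnorm_def)
qed

lemma gnorm_triangle: "gnorm (v + w) \<le> gnorm v + gnorm w"
  unfolding gnorm_def [of "v + w"]
proof (rule cSUP_least)
  show "G \<noteq> {}" using one_in by blast
  fix A assume A: "A \<in> G"
  have "norm (A *v (v + w)) \<le> norm (A *v v) + norm (A *v w)"
    by (simp add: matrix_vector_right_distrib norm_triangle_ineq)
  also have "\<dots> \<le> gnorm v + gnorm w"
    unfolding gnorm_def by (intro add_mono cSUP_upper A bdd)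
  finally show "norm (A *v (v + w)) \<le> gnorm v + gnorm w" .
qed

lemma gnorm_scale: "gnorm (c *s v) = norm c * gnorm v"
proof -
  have le: "gnorm (c *s v) \<le> norm c * gnorm v" for c v
    unfolding gnorm_def [of "c *s v"]
  proof (rule cSUP_least)
    show "G \<noteq> {}" using one_in by blast
    fix A assume A: "A \<in> G"
    have "norm (A *v (c *s v)) = norm c * norm (A *v v)"
      by (simp add: vec.scale norm_vector_scale)
    also have "\<dots> \<le> norm c * gnorm v"
      unfolding gnorm_def by (intro mult_left_mono cSUP_upper A bdd) auto
    finally show "norm (A *v (c *s v)) \<le> norm c * gnorm v" .
  qed
  show ?thesis
  proof (cases "c = 0")
    case True
    then show ?thesis using le [of c v] norm_le_gnorm [of "c *s v"] norm_ge_zero [of "c *s v"] by simp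
  next
    case False
    have "norm c * gnorm v = norm c * gnorm (inverse c *s (c *s v))" using False by simp
    also have "\<dots> \<le> norm c * (norm (inverse c) * gnorm (c *s v))"
      by (intro mult_left_mono le) auto
    also have "\<dots> = gnorm (c *s v)" using False by (simp add: norm_inverse)
    finally show ?thesis using le [of c v] by simp
  qed
qed

lemma gnorm_pos: "v \<noteq> 0 \<Longrightarrow> gnorm v > 0"
  using norm_le_gnorm [of v] by (metis less_le_trans zero_less_norm_iff)

lemma eigenvalue_unimodular:
  assumes "A \<in> G" "v \<noteq> 0" "A *v v = c *s v"
  shows "norm c = 1"
  using gnorm_invariant [OF assms(1), of v] gnorm_pos [OF assms(2)]
  by (simp add: assms(3) gnorm_scale)

text \<open>The powers of \<open>A\<close> move \<open>v\<close> to \<open>v + k w\<close>, which must stay bounded.\<close>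

lemma no_jordan_block:
  assumes "A \<in> G" "A *v v = v + w" "A *v w = w"
  shows "w = 0"
proof (rule ccontr)
  assume w: "w \<noteq> 0"
  have inv: "gnorm (v + of_nat k *s w) = gnorm v" for k
  proof (induction k)
    case (Suc k)
    have "A *v (v + of_nat k *s w) = v + of_nat (Suc k) *s w"
      using assms by (simp add: matrix_vector_right_distrib vec.scale vec.scale_left_distrib add.assoc)
    then show ?case using gnorm_invariant [OF assms(1), of "v + of_nat k *s w"] Suc by simp
  qed simp
  obtain k :: nat where k: "2 * gnorm v < real k * gnorm w"
    using reals_Archimedean3 [OF gnorm_pos [OF w]] by blast
  have "real k * gnorm w = gnorm ((v + of_nat k *s w) + (-1) *s v)"
    by (simp add: gnorm_scale)
  also have "\<dots> \<le> gnorm v + gnorm v"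
    using gnorm_triangle [of "v + of_nat k *s w" "(-1) *s v"] inv [of k] gnorm_scale [of "-1" v] by simp
  finally show False using k by simp
qed

text \<open>On a nonzero range of \<open>A - 1\<close> there would be an eigenvector \<open>w = A v - v\<close>, necessarily for the eigenvalue
  1, so that \<open>v\<close> and \<open>w\<close> would span a Jordan block.\<close>

lemma identity_if_only_eigenvalue_1:
  assumes "A \<in> G" "\<And>c v. v \<noteq> 0 \<Longrightarrow> A *v v = c *s v \<Longrightarrow> c = 1"
  shows "A = mat 1"
proof -
  let ?W = "range ((*v) (A - mat 1))"
  have sub: "vec.subspace ?W" by (intro vec.subspace_image) (simp add: vec.subspace_UNIV)
  have "?W = {0}"
  proof (rule ccontr)
    assume nz: "?W \<noteq> {0}"
    have inv: "A *v w \<in> ?W" if w: "w \<in> ?W" for w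
    proof -
      obtain u where "w = (A - mat 1) *v u" using w by blast
      then have "A *v w = (A - mat 1) *v (A *v u)"
        by (simp add: matrix_vector_mult_diff_rdistrib matrix_vector_mult_diff_distrib)
      then show ?thesis by blast
    qed
    obtain c w where w: "w \<in> ?W" "w \<noteq> 0" "A *v w = c *s w"
      using eigenvector_in_invariant_subspace [OF sub nz inv] by auto
    then obtain v where "w = A *v v - v" by (auto simp: matrix_vector_mult_diff_rdistrib)
    moreover have "A *v w = w" using w assms(2) by force
    ultimately show False using no_jordan_block [OF assms(1), of v w] w by simp
  qed
  then have "(A - mat 1) *v v = 0" for v by blast
  then have "A *v v = mat 1 *v v" for v by (simp add: matrix_vector_mult_diff_rdistrib)
  then show ?thesis by (simp add: matrix_eq)
qed

text \<open>The difference \<open>A B A\<inverse> - B\<close> is the ring commutator of \<open>A\<close> and \<open>B A\<inverse>\<close>.\<close>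

lemma eigenvalue_difference_real:
  assumes A: "A \<in> G" and B: "B \<in> G" and w: "w \<noteq> 0"
    and "(A ** B ** matrix_inv A) *v w = b' *s w" "B *v w = b *s w"
  shows "b' - b \<in> \<real>"
proof -
  have "ring_commutator A (B ** matrix_inv A) = A ** B ** matrix_inv A - B"
    using A by (simp add: ring_commutator_def matrix_mul_assoc)
  then have "ring_commutator A (B ** matrix_inv A) *v w = (b' - b) *s w"
    using assms by (simp add: matrix_vector_mult_diff_rdistrib vec.scale_left_diff_distrib)
  then have "b' - b \<in> spectrum (ring_commutator A (B ** matrix_inv A))"
    using w by (auto simp: spectrum_def)
  then show ?thesis using real_spec A mult_in [OF B inv_in [OF A]] by blast
qed

lemma conjugate_eigenvalues:
  assumes A: "A \<in> G" and B: "B \<in> G" and w: "w \<noteq> 0"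
    and eig: "(A ** B ** matrix_inv A) *v w = b' *s w" "B *v w = b *s w"
  shows "b' = b \<or> (b = 1 \<or> b = -1) \<and> b' = -b"
proof (rule unimodular_dichotomy)
  show "norm b = 1" "norm b' = 1" using A B w eig eigenvalue_unimodular [of B] eigenvalue_unimodular [of "A ** B ** matrix_inv A"]
    by simp_all
  show "b' - b \<in> \<real>" using assms by (rule eigenvalue_difference_real)
  have "(B ** B) *v w = b\<^sup>2 *s w"
    using eig by (simp add: matrix_vector_mul_assoc [symmetric] vec.scale power2_eq_square)
  moreover have "(A ** (B ** B) ** matrix_inv A) *v w = b'\<^sup>2 *s w"
  proof -
    have "A ** (B ** B) ** matrix_inv A = (A ** B ** matrix_inv A) ** (A ** B ** matrix_inv A)"
      using A by (simp add: matrix_mul_assoc)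
    then show ?thesis
      using eig by (simp add: matrix_vector_mul_assoc [symmetric] vec.scale power2_eq_square)
  qed
  ultimately show "b'\<^sup>2 - b\<^sup>2 \<in> \<real>"
    using A B w by (intro eigenvalue_difference_real [of A "B ** B"]) auto
qed

text \<open>It suffices to see that \<open>U = B'\<^sup>2 B\<^sup>-\<^sup>2\<close> has no eigenvalue other than 1. Each eigenspace of \<open>U\<close> contains
  a common eigenvector of \<open>B\<close> and \<open>B'\<close>, to which \<open>conjugate_eigenvalues\<close> applies.\<close>

lemma square_eq_if_conjugate_commutes:
  assumes A: "A \<in> G" and B: "B \<in> G" and B': "B' = A ** B ** matrix_inv A"
    and comm: "B' ** B = B ** B'"
  shows "B' ** B' = B ** B"
proof -
  define U where "U = B' ** B' ** matrix_inv (B ** B)"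
  have B'G: "B' \<in> G" using A B B' by simp
  have UBB: "U ** (B ** B) = B' ** B'" using B by (simp add: U_def)
  have square_comm: "X ** (Y ** Y) = Y ** Y ** X" if c: "X ** Y = Y ** X" for X Y :: "complex ^ 'n ^ 'n"
  proof -
    have "X ** (Y ** Y) = X ** Y ** Y" by (simp only: matrix_mul_assoc)
    also have "\<dots> = Y ** X ** Y" by (simp only: c)
    also have "\<dots> = Y ** (X ** Y)" by (simp only: matrix_mul_assoc)
    also have "\<dots> = Y ** (Y ** X)" by (simp only: c)
    finally show ?thesis by (simp only: matrix_mul_assoc)
  qed
  have commU: "X ** U = U ** X" if X: "X = B \<or> X = B'" for X
  proof -
    have XB: "X ** (B ** B) = B ** B ** X" and XB': "X ** (B' ** B') = B' ** B' ** X"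
      using X comm by (auto intro!: square_comm)
    have "X ** U ** (B ** B) = X ** (U ** (B ** B))" by (simp only: matrix_mul_assoc)
    also have "\<dots> = U ** (B ** B) ** X" by (simp only: UBB XB')
    also have "\<dots> = U ** (B ** B ** X)" by (simp only: matrix_mul_assoc)
    also have "\<dots> = U ** (X ** (B ** B))" by (simp only: XB)
    also have "\<dots> = U ** X ** (B ** B)" by (simp only: matrix_mul_assoc)
    finally have "X ** U ** (B ** B) ** matrix_inv (B ** B) = U ** X ** (B ** B) ** matrix_inv (B ** B)"
      by (simp only:)
    then show ?thesis using B by simp
  qed
  have "U = mat 1"
  proof (rule identity_if_only_eigenvalue_1)
    show "U \<in> G" using B B'G by (simp add: U_def)
    fix c v assume v: "v \<noteq> 0" "U *v v = c *s v"
    let ?W = "{v \<in> UNIV. U *v v = c *s v}"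
    have sub: "vec.subspace ?W" by (rule subspace_eigenspace) (simp add: vec.subspace_UNIV)
    have inv: "X *v w \<in> ?W" if "X \<in> {B, B'}" "w \<in> ?W" for X w
    proof -
      have "X ** U = U ** X" using commU [of X] that by blast
      then have "U *v (X *v w) = X *v (U *v w)" by (simp add: matrix_vector_mul_assoc)
      then show ?thesis using that by (simp add: vec.scale)
    qed
    have cm: "X *v (Y *v w) = Y *v (X *v w)" if "X \<in> {B, B'}" "Y \<in> {B, B'}" for X Y w
      using that comm by (auto simp: matrix_vector_mul_assoc)
    have nz: "?W \<noteq> {0}" using v by blast
    obtain w where w: "w \<in> ?W" "w \<noteq> 0" "\<forall>X\<in>{B, B'}. \<exists>c. X *v w = c *s w"
      using common_eigenvector [of ?W "{B, B'}", OF sub nz inv cm] by auto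
    then obtain b b' where b: "B *v w = b *s w" "B' *v w = b' *s w" by blast
    have bb: "b'\<^sup>2 = b\<^sup>2"
      using conjugate_eigenvalues [OF A B w(2), of b' b] b B' by auto
    have "(U ** (B ** B)) *v w = (c * b\<^sup>2) *s w"
      using w(1) b by (simp add: matrix_vector_mul_assoc [symmetric] vec.scale power2_eq_square)
    moreover have "(B' ** B') *v w = b\<^sup>2 *s w"
      using b bb by (simp add: matrix_vector_mul_assoc [symmetric] vec.scale power2_eq_square)
    ultimately have "c * b\<^sup>2 = b\<^sup>2" using UBB w(2) by simp
    moreover have "b \<noteq> 0" using eigenvalue_unimodular [OF B w(2) b(1)] by auto
    ultimately show "c = 1" by simp
  qed
  then show ?thesis using UBB by simp
qed

lemma commutes_with_square:
  assumes A: "A \<in> G" and B: "B \<in> G"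
    and comm: "A ** B ** matrix_inv A ** B = B ** (A ** B ** matrix_inv A)"
  shows "A ** (B ** B) = B ** B ** A"
proof -
  have "A ** B ** matrix_inv A ** (A ** B ** matrix_inv A) = B ** B"
    using square_eq_if_conjugate_commutes [OF A B refl comm] .
  then have "A ** B ** matrix_inv A ** (A ** B ** matrix_inv A) ** A = B ** B ** A" by simp
  then show ?thesis using A by (simp add: matrix_mul_assoc)
qed

text \<open>If \<open>Y w = y w\<close> with \<open>w\<close> in \<open>W\<close>, then \<open>X w\<close> is an eigenvector of \<open>X Y X\<inverse>\<close> for \<open>y\<close> and of \<open>Y\<close> for \<open>y / u\<close>, so
  that \<open>y - y / u\<close> is real. The same at the eigenvector \<open>X w\<close> shows that \<open>(y - y / u) / u\<close> is real.
  Hence \<open>u\<close> is real of modulus 1, that is \<open>u = -1\<close>, and \<open>2 y\<close> is real.\<close>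

lemma twisted_eigenvalue:
  assumes X: "X \<in> G" and Y: "Y \<in> G" and XW: "\<And>w. w \<in> W \<Longrightarrow> X *v w \<in> W"
    and tw: "\<And>w. w \<in> W \<Longrightarrow> X *v (Y *v w) = u *s (Y *v (X *v w))" and "u \<noteq> 1"
    and w: "w \<in> W" "w \<noteq> 0" "Y *v w = y *s w"
  shows "u = -1" "y\<^sup>2 = 1"
proof -
  have step: "Y *v (X *v v) = (z / u) *s (X *v v) \<and> z - z / u \<in> \<real> \<and> u \<noteq> 0"
    if v: "v \<in> W" "v \<noteq> 0" "Y *v v = z *s v" for v z
  proof -
    have z: "norm z = 1" using eigenvalue_unimodular [OF Y v(2,3)] .
    have e: "u *s (Y *v (X *v v)) = z *s (X *v v)"
      using tw [OF v(1)] v(3) by (simp add: vec.scale)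
    then have u: "u \<noteq> 0" using X v z by auto
    have Yv: "Y *v (X *v v) = (z / u) *s (X *v v)"
    proof -
      have "Y *v (X *v v) = inverse u *s (u *s (Y *v (X *v v)))" using u by simp
      then show ?thesis unfolding e by (simp add: field_simps)
    qed
    have "(X ** Y ** matrix_inv X) *v (X *v v) = z *s (X *v v)"
      using X v by (simp add: matrix_vector_mul_assoc [symmetric] vec.scale)
    then have "z - z / u \<in> \<real>"
      using eigenvalue_difference_real [OF X Y _ _ Yv] X v by simp
    then show ?thesis using Yv u by blast
  qed
  have s1: "Y *v (X *v w) = (y / u) *s (X *v w)" "y - y / u \<in> \<real>" "u \<noteq> 0" using step [OF w] by auto
  have s2: "y / u - y / u / u \<in> \<real>" using step [OF XW [OF w(1)] _ s1(1)] X w by simp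
  have y: "norm y = 1" using eigenvalue_unimodular [OF Y w(2,3)] .
  have "norm (y / u) = 1" using eigenvalue_unimodular [OF Y _ s1(1)] X w by simp
  then have nu: "norm u = 1" using y by (simp add: norm_divide divide_eq_1_iff)
  have "y - y / u \<noteq> 0" using y \<open>u \<noteq> 1\<close> \<open>u \<noteq> 0\<close> by (auto simp: field_simps)
  then have "u = (y - y / u) / (y / u - y / u / u)"
    using \<open>u \<noteq> 0\<close> by (auto simp: field_simps)
  then have "u \<in> \<real>" using s1(2) s2 by (metis Reals_divide)
  then obtain r where "u = of_real r" by (auto elim: Reals_cases)
  then have "\<bar>r\<bar> = 1" using nu by simp
  then show um: "u = -1" using \<open>u = of_real r\<close> \<open>u \<noteq> 1\<close> by (cases "r \<ge> 0") auto
  have "2 * y \<in> \<real>" using s1(2) um by simp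
  then have "y \<in> \<real>" using Reals_divide [of "2 * y" 2] by simp
  then obtain r where "y = of_real r" by (auto elim: Reals_cases)
  then have "\<bar>r\<bar> = 1" using y by simp
  then have "r = 1 \<or> r = -1" by linarith
  then show "y\<^sup>2 = 1" using \<open>y = of_real r\<close> by auto
qed

lemma eigenvalue_of_square:
  fixes X :: "complex ^ 'n ^ 'n"
  assumes W: "vec.subspace W" "\<And>w. w \<in> W \<Longrightarrow> X *v w \<in> W"
    and w: "w \<in> W" "w \<noteq> 0" "X *v (X *v w) = a\<^sup>2 *s w"
  obtains y v where "v \<in> W" "v \<noteq> 0" "X *v v = y *s v" "y\<^sup>2 = a\<^sup>2"
proof (cases "X *v w + a *s w = 0")
  case True
  then have "X *v w = (-a) *s w" by (simp add: eq_neg_iff_add_eq_0)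
  then show ?thesis using that [of w "-a"] w by simp
next
  case False
  have "X *v (X *v w + a *s w) = a *s (X *v w + a *s w)"
    using w by (simp add: matrix_vector_right_distrib vec.scale vec.scale_right_distrib power2_eq_square)
  moreover have "X *v w + a *s w \<in> W" using W w by (simp add: vec.subspace_add vec.subspace_scale)
  ultimately show ?thesis using that [of "X *v w + a *s w" a] False by blast
qed

text \<open>If \<open>u \<noteq> 1\<close>, then \<open>A\<close> and \<open>B\<close> anticommute on \<open>W\<close>, and so do \<open>A\<close> and \<open>A B\<close>. By \<open>twisted_eigenvalue\<close> all three
  of \<open>A\<close>, \<open>B\<close>, \<open>A B\<close> have only the eigenvalues \<open>\<plusminus>1\<close> on \<open>W\<close>. On a common eigenvector of \<open>B\<close> and \<open>A\<^sup>2\<close> this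
  contradicts \<open>(A B)\<^sup>2 = - A\<^sup>2 B\<^sup>2\<close>.\<close>

lemma no_twisted_commutation:
  assumes A: "A \<in> G" and B: "B \<in> G" and W: "vec.subspace W" "W \<noteq> {0}"
    and AW: "\<And>w. w \<in> W \<Longrightarrow> A *v w \<in> W" and BW: "\<And>w. w \<in> W \<Longrightarrow> B *v w \<in> W"
    and tw: "\<And>w. w \<in> W \<Longrightarrow> A *v (B *v w) = u *s (B *v (A *v w))"
  shows "u = 1"
proof (rule ccontr)
  assume u: "u \<noteq> 1"
  obtain b0 w0 where w0: "w0 \<in> W" "w0 \<noteq> 0" "B *v w0 = b0 *s w0"
    using eigenvector_in_invariant_subspace [OF W BW] by auto
  have um: "u = -1" using twisted_eigenvalue(1) [OF A B AW tw u w0] .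
  then have anti: "A *v (B *v w) = - (B *v (A *v w))" if "w \<in> W" for w
    using tw [OF that] um by simp
  have antiA: "A *v (B *v w) = (-1) *s (B *v (A *v w))"
    and antiB: "B *v (A *v w) = (-1) *s (A *v (B *v w))" if "w \<in> W" for w
    using anti [OF that] by simp_all
  have neg: "(-1::complex) \<noteq> 1" by simp
  have eB: "y\<^sup>2 = 1" if "w \<in> W" "w \<noteq> 0" "B *v w = y *s w" for y w
    by (rule twisted_eigenvalue(2) [OF A B AW antiA neg that])
  have eA: "y\<^sup>2 = 1" if "w \<in> W" "w \<noteq> 0" "A *v w = y *s w" for y w
    by (rule twisted_eigenvalue(2) [OF B A BW antiB neg that])
  have eAB: "y\<^sup>2 = 1" if "w \<in> W" "w \<noteq> 0" "(A ** B) *v w = y *s w" for y w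
  proof (rule twisted_eigenvalue(2) [OF A _ AW _ neg that])
    show "A ** B \<in> G" using A B by simp
    show "A *v ((A ** B) *v w) = (- 1) *s ((A ** B) *v (A *v w))" if "w \<in> W" for w
      using anti [OF that] by (simp add: matrix_vector_mul_assoc [symmetric] vec.neg)
  qed
  have "\<exists>w\<in>W. w \<noteq> 0 \<and> (\<forall>X\<in>{B, A ** A}. \<exists>c. X *v w = c *s w)"
  proof (rule common_eigenvector [OF W, of "{B, A ** A}"])
    show "X *v w \<in> W" if "X \<in> {B, A ** A}" "w \<in> W" for X w
      using that AW BW by (auto simp: matrix_vector_mul_assoc [symmetric])
    have "(A ** A) *v (B *v w) = B *v ((A ** A) *v w)" if "w \<in> W" for w
      using anti [OF that] anti [OF AW [OF that]]
      by (simp add: matrix_vector_mul_assoc [symmetric] vec.neg)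
    note AAB = this
    show "X *v (Y *v w) = Y *v (X *v w)"
      if "X \<in> {B, A ** A}" "Y \<in> {B, A ** A}" "w \<in> W" for X Y w
      using that(1,2) AAB [OF that(3)] by auto
  qed
  then obtain w b \<alpha> where w: "w \<in> W" "w \<noteq> 0" "B *v w = b *s w" "(A ** A) *v w = \<alpha> *s w" by auto
  have AAw: "A *v (A *v w) = (csqrt \<alpha>)\<^sup>2 *s w" using w by (simp add: matrix_vector_mul_assoc)
  obtain y v where v: "v \<in> W" "v \<noteq> 0" "A *v v = y *s v" "y\<^sup>2 = (csqrt \<alpha>)\<^sup>2"
    by (rule eigenvalue_of_square [OF W(1) AW w(1,2) AAw])
  have "\<alpha> = 1" using eA [OF v(1-3)] v(4) by simp
  then have AAw1: "A *v (A *v w) = w" using w by (simp add: matrix_vector_mul_assoc)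
  have bb: "b * b = 1" using eB [OF w(1-3)] by (simp add: power2_eq_square)
  have "(A ** B) *v ((A ** B) *v w) = - (A *v (A *v (B *v (B *v w))))"
    using anti [OF BW [OF w(1)]] by (simp add: matrix_vector_mul_assoc [symmetric] vec.neg)
  also have "\<dots> = \<i>\<^sup>2 *s w" using w(3) AAw1 bb by (simp add: vec.scale)
  finally have AB2: "(A ** B) *v ((A ** B) *v w) = \<i>\<^sup>2 *s w" .
  have ABW: "(A ** B) *v w \<in> W" if "w \<in> W" for w
    using that AW BW by (simp add: matrix_vector_mul_assoc [symmetric])
  obtain y v where v: "v \<in> W" "v \<noteq> 0" "(A ** B) *v v = y *s v" "y\<^sup>2 = \<i>\<^sup>2"
    by (rule eigenvalue_of_square [OF W(1) ABW w(1,2) AB2])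
  show False using eAB [OF v(1-3)] v(4) by simp
qed

text \<open>The eigenspaces of \<open>K\<close> are invariant under \<open>A\<close> and \<open>B\<close>, and on the one for \<open>c\<close> the relation \<open>A B = c B A\<close> holds.\<close>

lemma central_commutator_trivial:
  assumes A: "A \<in> G" and B: "B \<in> G" and K: "K = A ** B ** matrix_inv A ** matrix_inv B"
    and KA: "K ** A = A ** K" and KB: "K ** B = B ** K"
  shows "K = mat 1"
proof (rule identity_if_only_eigenvalue_1)
  show "K \<in> G" using A B K by simp
  fix c v assume v: "v \<noteq> 0" "K *v v = c *s v"
  let ?W = "{v \<in> UNIV. K *v v = c *s v}"
  have sub: "vec.subspace ?W" by (rule subspace_eigenspace) (simp add: vec.subspace_UNIV)
  have inv: "X *v w \<in> ?W" if "X = A \<or> X = B" "w \<in> ?W" for X w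
  proof -
    have "K ** X = X ** K" using KA KB that by auto
    then have "K *v (X *v w) = X *v (K *v w)"
      by (simp add: matrix_vector_mul_assoc)
    then show ?thesis using that by (simp add: vec.scale)
  qed
  have AB: "A ** B = K ** B ** A" using A B by (simp add: K)
  show "c = 1"
  proof (rule no_twisted_commutation [OF A B sub])
    show "?W \<noteq> {0}" using v by blast
    show "A *v (B *v w) = c *s (B *v (A *v w))" if "w \<in> ?W" for w
    proof -
      have "A *v (B *v w) = K *v (B *v (A *v w))"
        by (simp add: matrix_vector_mul_assoc matrix_mul_assoc AB)
      moreover have "B *v (A *v w) \<in> ?W"
        by (intro inv [of B] inv [of A] that) simp_all
      ultimately show ?thesis by simp
    qed
    show "A *v w \<in> ?W" "B *v w \<in> ?W" if "w \<in> ?W" for w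
      by (intro inv [of A] inv [of B] that, simp)+
  qed
qed

section \<open>Commutativity near the identity\<close>

text \<open>Here \<open>N\<close> is a tangent vector to the group at the identity, along the sequence \<open>K\<close>. Since the members
  of the group are isometries, \<open>gnorm\<close> is stationary to first order in the direction \<open>N x\<close>.\<close>

lemma tangent_vector:
  fixes K :: "nat \<Rightarrow> complex ^ 'n ^ 'n"
  assumes K: "\<And>k. K k \<in> G" and e: "\<And>k. e k > 0"
    and N: "(\<lambda>k. (1 / e k) *\<^sub>R (K k - mat 1)) \<longlonglongrightarrow> N"
  shows "(\<lambda>k. (gnorm (x + e k *\<^sub>R (N *v x)) - gnorm x) / e k) \<longlonglongrightarrow> 0"
proof -
  obtain R where R: "R > 0" "\<And>v. gnorm v \<le> R * norm v" using gnorm_bound by blast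
  define D where "D k = N - (1 / e k) *\<^sub>R (K k - mat 1)" for k
  have D0: "D \<longlonglongrightarrow> 0"
    unfolding D_def using tendsto_diff [OF tendsto_const N, of N] by simp
  have bound: "\<bar>(gnorm (x + e k *\<^sub>R (N *v x)) - gnorm x) / e k\<bar> \<le> R * (norm (D k) * norm x)" for k
  proof -
    have ek: "e k > 0" by (rule e)
    have "K k - mat 1 = e k *\<^sub>R (N - D k)" using ek by (simp add: D_def)
    then have "K k = mat 1 + e k *\<^sub>R (N - D k)" by (simp add: algebra_simps)
    then have "K k *v x = x + (e k *\<^sub>R (N - D k)) *v x"
      by (simp add: matrix_vector_mult_add_rdistrib)
    also have "\<dots> = x + e k *\<^sub>R (N *v x) - e k *\<^sub>R (D k *v x)"
      by (simp add: scaleR_matrix_vector matrix_vector_mult_diff_rdistrib algebra_simps)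
    finally have Kx: "x + e k *\<^sub>R (N *v x) = K k *v x + of_real (e k) *s (D k *v x)"
      by (simp add: scaleR_conv_scale [symmetric])
    have t: "gnorm (of_real (e k) *s (D k *v x)) = e k * gnorm (D k *v x)"
      "gnorm (- of_real (e k) *s (D k *v x)) = e k * gnorm (D k *v x)"
      using ek by (simp_all only: gnorm_scale) simp_all
    have "gnorm (x + e k *\<^sub>R (N *v x)) \<le> gnorm x + e k * gnorm (D k *v x)"
      using gnorm_triangle [of "K k *v x" "of_real (e k) *s (D k *v x)"] K [of k] t by (simp add: Kx)
    moreover have "gnorm x \<le> gnorm (x + e k *\<^sub>R (N *v x)) + e k * gnorm (D k *v x)"
    proof -
      have "K k *v x = (x + e k *\<^sub>R (N *v x)) + (- of_real (e k)) *s (D k *v x)"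
        by (simp add: Kx)
      then have "gnorm (K k *v x) \<le> gnorm (x + e k *\<^sub>R (N *v x)) + e k * gnorm (D k *v x)"
        using gnorm_triangle [of "x + e k *\<^sub>R (N *v x)" "(- of_real (e k)) *s (D k *v x)"] t by simp
      then show ?thesis using K [of k] by simp
    qed
    ultimately have "\<bar>gnorm (x + e k *\<^sub>R (N *v x)) - gnorm x\<bar> \<le> gnorm (D k *v x) * e k"
      by (simp add: mult.commute)
    then have "\<bar>(gnorm (x + e k *\<^sub>R (N *v x)) - gnorm x) / e k\<bar> \<le> gnorm (D k *v x)"
      using ek by (simp add: pos_divide_le_eq)
    also have "\<dots> \<le> R * norm (D k *v x)" by (rule R(2))
    also have "\<dots> \<le> R * (norm (D k) * norm x)"
      using R(1) norm_matrix_vector_le by (intro mult_left_mono) auto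
    finally show ?thesis .
  qed
  have "(\<lambda>k. R * (norm (D k) * norm x)) \<longlonglongrightarrow> R * (norm (0 :: complex ^ 'n ^ 'n) * norm x)"
    by (intro tendsto_intros D0)
  then have lim: "(\<lambda>k. R * (norm (D k) * norm x)) \<longlonglongrightarrow> 0" by simp
  show ?thesis
    by (rule Lim_null_comparison [OF _ lim]) (use bound in auto)
qed

text \<open>Along an eigenvector, the derivative of \<open>gnorm\<close> in direction \<open>c v\<close> is \<open>Re c * gnorm v\<close>.\<close>

lemma tangent_eigenvalue_imaginary:
  assumes K: "\<And>k. K k \<in> G" and e: "\<And>k. e k > 0" "e \<longlonglongrightarrow> 0"
    and N: "(\<lambda>k. (1 / e k) *\<^sub>R (K k - mat 1)) \<longlonglongrightarrow> N"
    and v: "v \<noteq> 0" "N *v v = c *s v"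
  shows "Re c = 0"
proof -
  have eq: "(gnorm (v + e k *\<^sub>R (N *v v)) - gnorm v) / e k
      = (2 * Re c + e k * (norm c)\<^sup>2) / (norm (1 + of_real (e k) * c) + 1) * gnorm v" for k
  proof -
    have ek: "e k > 0" by (rule e)
    let ?n = "norm (1 + of_real (e k) * c)"
    have ev: "v + e k *\<^sub>R (N *v v) = (1 + of_real (e k) * c) *s v"
      by (simp add: v scaleR_conv_scale vec.scale_left_distrib)
    have g: "gnorm (v + e k *\<^sub>R (N *v v)) = ?n * gnorm v" by (simp only: ev gnorm_scale)
    have "(?n - 1) * (?n + 1) = ?n\<^sup>2 - 1" by (simp add: power2_eq_square algebra_simps)
    also have "\<dots> = e k * (2 * Re c + e k * (norm c)\<^sup>2)"
      unfolding cmod_power2 by (simp add: power2_eq_square algebra_simps)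
    finally have "(?n - 1) / e k = (2 * Re c + e k * (norm c)\<^sup>2) / (?n + 1)"
      using ek by (simp add: divide_simps mult.commute add_pos_nonneg add_nonneg_eq_0_iff)
    then have "(?n - 1) / e k * gnorm v = (2 * Re c + e k * (norm c)\<^sup>2) / (?n + 1) * gnorm v"
      by simp
    then show ?thesis by (simp add: g left_diff_distrib)
  qed
  have "(\<lambda>k. (2 * Re c + e k * (norm c)\<^sup>2) / (norm (1 + of_real (e k) * c) + 1) * gnorm v)
     \<longlonglongrightarrow> (2 * Re c + 0 * (norm c)\<^sup>2) / (norm (1 + of_real 0 * c) + 1) * gnorm v"
    by (intro tendsto_intros e) simp
  then have "(\<lambda>k. (gnorm (v + e k *\<^sub>R (N *v v)) - gnorm v) / e k) \<longlonglongrightarrow> Re c * gnorm v"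
    by (simp add: eq)
  then have "Re c * gnorm v = 0"
    using tangent_vector [OF K e(1) N] LIMSEQ_unique by blast
  then show ?thesis using gnorm_pos [OF v(1)] by simp
qed

text \<open>On the line \<open>s \<mapsto> u + s w\<close> the direction \<open>N x\<close> is constantly \<open>w\<close>, so the convex function \<open>gnorm\<close> is
  stationary at each of its points. Convexity bounds it by its value at \<open>s = 0\<close>, but it is unbounded
  unless \<open>w = 0\<close>.\<close>

lemma tangent_no_jordan_block:
  assumes K: "\<And>k. K k \<in> G" and e: "\<And>k. e k > 0"
    and N: "(\<lambda>k. (1 / e k) *\<^sub>R (K k - mat 1)) \<longlonglongrightarrow> N"
    and w: "N *v u = w" "N *v w = 0"
  shows "w = 0"
proof (rule ccontr)
  assume w0: "w \<noteq> 0"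
  define \<phi> where "\<phi> s = gnorm (u + of_real s *s w)" for s :: real
  have le: "\<phi> s \<le> gnorm u" if s: "s > 0" for s
  proof -
    let ?x = "u + of_real s *s w"
    have Nx: "N *v ?x = w" by (simp add: w matrix_vector_right_distrib vec.scale)
    (* Slopes of the convex function phi increase: the one on [0, s] is at most the one on [s, s + e k]. *)
    have conv: "(\<phi> s - gnorm u) / s \<le> (gnorm (?x + e k *\<^sub>R (N *v ?x)) - gnorm ?x) / e k" for k
    proof -
      have ek: "e k > 0" by (rule e)
      have x: "?x + e k *\<^sub>R (N *v ?x) = u + of_real (s + e k) *s w"
        unfolding Nx by (simp add: scaleR_conv_scale vec.scale_left_distrib add.assoc)
      have "of_real (s + e k) *s ?x = of_real (e k) *s u + of_real s *s (u + of_real (s + e k) *s w)"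
        by (simp add: vec_eq_iff algebra_simps)
      then have "gnorm (of_real (s + e k) *s ?x) \<le> gnorm (of_real (e k) *s u)
          + gnorm (of_real s *s (u + of_real (s + e k) *s w))"
        by (simp only: gnorm_triangle)
      then have "(s + e k) * \<phi> s \<le> e k * gnorm u + s * \<phi> (s + e k)"
        using s ek unfolding gnorm_scale by (simp add: \<phi>_def del: of_real_add)
      moreover have "gnorm (?x + e k *\<^sub>R (N *v ?x)) = \<phi> (s + e k)" "gnorm ?x = \<phi> s"
        by (simp_all only: x \<phi>_def)
      ultimately show ?thesis using s ek by (simp only:) (simp add: field_simps)
    qed
    have "(\<phi> s - gnorm u) / s \<le> 0"
      by (rule LIMSEQ_le_const [OF tangent_vector [OF K e N]]) (use conv in blast)
    then show ?thesis using s by (simp add: divide_le_0_iff)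
  qed
  define s where "s = 2 * gnorm u / gnorm w + 1"
  have "gnorm u \<ge> 0" using norm_ge_zero norm_le_gnorm by (rule order_trans)
  then have s: "s > 0" using gnorm_pos [OF w0]
    unfolding s_def by (intro add_nonneg_pos divide_nonneg_pos) auto
  have "s * gnorm w = gnorm (of_real s *s w)" using s by (simp add: gnorm_scale)
  also have "of_real s *s w = (u + of_real s *s w) + (-1) *s u" by simp
  also have "gnorm \<dots> \<le> \<phi> s + gnorm u"
    using gnorm_triangle [of "u + of_real s *s w" "(-1) *s u"] gnorm_scale [of "-1" u]
    by (simp add: \<phi>_def)
  also have "\<dots> \<le> 2 * gnorm u" using le [OF s] by simp
  finally have "s * gnorm w \<le> 2 * gnorm u" .
  moreover have "s * gnorm w = 2 * gnorm u + gnorm w"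
    using gnorm_pos [OF w0] by (simp add: s_def distrib_right)
  ultimately show False using gnorm_pos [OF w0] by linarith
qed

lemma tangent_trivial:
  assumes K: "\<And>k. K k \<in> G" and e: "\<And>k. e k > 0" "e \<longlonglongrightarrow> 0"
    and N: "(\<lambda>k. (1 / e k) *\<^sub>R (K k - mat 1)) \<longlonglongrightarrow> N"
    and real: "spectrum N \<subseteq> \<real>"
  shows "N = 0"
proof -
  let ?W = "range ((*v) N)"
  have sub: "vec.subspace ?W" by (intro vec.subspace_image) (simp add: vec.subspace_UNIV)
  have "?W = {0}"
  proof (rule ccontr)
    assume nz: "?W \<noteq> {0}"
    obtain c w where w: "w \<in> ?W" "w \<noteq> 0" "N *v w = c *s w"
      using eigenvector_in_invariant_subspace [OF sub nz, of N] by auto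
    have "c \<in> \<real>" using real w by (auto simp: spectrum_def)
    moreover have "Re c = 0" using tangent_eigenvalue_imaginary [OF K e N w(2,3)] .
    ultimately have "c = 0" by (simp add: complex_is_Real_iff complex_eq_iff)
    obtain u where "N *v u = w" using w by blast
    then have "w = 0" using tangent_no_jordan_block [OF K e(1) N, of u w] w \<open>c = 0\<close> by simp
    then show False using w by simp
  qed
  then have "N *v v = 0 *v v" for v by auto
  then show ?thesis by (simp add: matrix_eq)
qed

text \<open>With \<open>K = A B A\<inverse> B\<inverse>\<close> one has \<open>(K - 1) (B A) = A B - B A\<close>. For counterexamples \<open>A\<close>, \<open>B\<close> tending to 1, the
  normalised \<open>K - 1\<close> and the equally scaled ring commutators thus have the same limit point \<open>N\<close>, which has
  norm 1 and is both a limit of matrices with real spectra and a tangent vector.\<close>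

lemma commute_near_identity:
  obtains \<delta> where "\<delta> > 0"
    "\<And>A B. A \<in> G \<Longrightarrow> B \<in> G \<Longrightarrow> norm (A - mat 1) < \<delta> \<Longrightarrow> norm (B - mat 1) < \<delta> \<Longrightarrow> A ** B = B ** A"
proof (rule ccontr)
  assume "\<not> thesis"
  with that have neg: "\<exists>A B. A \<in> G \<and> B \<in> G \<and> norm (A - mat 1) < \<delta> \<and> norm (B - mat 1) < \<delta> \<and> A ** B \<noteq> B ** A"
    if "\<delta> > 0" for \<delta>
    using \<open>\<delta> > 0\<close> by blast
  define d where "d k = inverse (real (Suc k))" for k
  have d: "d k > 0" for k by (simp add: d_def)
  have "\<forall>k. \<exists>A B. A \<in> G \<and> B \<in> G \<and> norm (A - mat 1) < d k \<and> norm (B - mat 1) < d k \<and> A ** B \<noteq> B ** A"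
    using neg d by simp
  then obtain A B where AB: "\<And>k. A k \<in> G" "\<And>k. B k \<in> G" "\<And>k. norm (A k - mat 1) < d k"
    "\<And>k. norm (B k - mat 1) < d k" "\<And>k. A k ** B k \<noteq> B k ** A k"
    by metis
  have d0: "d \<longlonglongrightarrow> 0" unfolding d_def by (rule LIMSEQ_inverse_real_of_nat)
  have lim1: "X \<longlonglongrightarrow> mat 1" if "\<And>k. norm (X k - mat 1) < d k" for X :: "nat \<Rightarrow> complex ^ 'n ^ 'n"
    by (rule LIM_zero_cancel, rule Lim_null_comparison [OF _ d0])
      (use that less_imp_le in \<open>auto intro!: always_eventually\<close>)
  have A1: "A \<longlonglongrightarrow> mat 1" and B1: "B \<longlonglongrightarrow> mat 1" using AB lim1 by auto
  note bb = bounded_bilinear.tendsto [OF bounded_bilinear_matrix_mult]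
  have M1: "(\<lambda>k. B k ** A k) \<longlonglongrightarrow> mat 1" using bb [OF B1 A1] by simp
  have C0: "(\<lambda>k. A k ** B k - B k ** A k) \<longlonglongrightarrow> 0"
    using tendsto_diff [OF bb [OF A1 B1] bb [OF B1 A1]] by simp
  define K where "K k = A k ** B k ** matrix_inv (B k ** A k)" for k
  have KG: "K k \<in> G" for k using AB by (simp add: K_def)
  have KM: "(K k - mat 1) ** (B k ** A k) = A k ** B k - B k ** A k" for k
    using AB by (simp add: K_def bounded_bilinear.diff_left [OF bounded_bilinear_matrix_mult])
  define e where "e k = norm (K k - mat 1)" for k
  have e: "e k > 0" for k
    using KM [of k] AB(5) [of k] by (auto simp: e_def)
  have e0: "e \<longlonglongrightarrow> 0"
  proof -
    obtain R where R: "R > 0" "\<And>A. A \<in> G \<Longrightarrow> norm A \<le> R" using norm_bound by blast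
    have "K k - mat 1 = (A k ** B k - B k ** A k) ** matrix_inv (B k ** A k)" for k
      using AB by (simp add: KM [symmetric] inv_mult(3) [of "B k ** A k" "K k - mat 1"])
    then have "e k \<le> norm (A k ** B k - B k ** A k) * norm (matrix_inv (B k ** A k))" for k
      unfolding e_def using norm_matrix_mult_le by metis
    moreover have "norm (matrix_inv (B k ** A k)) \<le> R" for k using AB R by simp
    ultimately have bd: "e k \<le> norm (A k ** B k - B k ** A k) * R" for k
      by (meson mult_left_mono norm_ge_zero order_trans)
    have "(\<lambda>k. norm (A k ** B k - B k ** A k) * R) \<longlonglongrightarrow> norm (0 :: complex ^ 'n ^ 'n) * R"
      by (intro tendsto_intros C0)
    then have lim: "(\<lambda>k. norm (A k ** B k - B k ** A k) * R) \<longlonglongrightarrow> 0" by simp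
    show ?thesis by (rule Lim_null_comparison [OF _ lim]) (use bd abs_of_pos [OF e] in \<open>auto intro!: always_eventually\<close>)
  qed
  define T where "T k = (1 / e k) *\<^sub>R (K k - mat 1)" for k
  have "T k \<in> sphere 0 1" for k using e [of k] by (simp add: T_def e_def)
  moreover have "seq_compact (sphere (0 :: complex ^ 'n ^ 'n) 1)"
    by (intro compact_imp_seq_compact) auto
  ultimately obtain N r where N: "N \<in> sphere 0 1" and r: "strict_mono r" and lim: "(T \<circ> r) \<longlonglongrightarrow> N"
    by (metis seq_compactE)
  have real: "spectrum N \<subseteq> \<real>"
  proof (rule real_spectrum_limit)
    have "(\<lambda>k. T (r k) ** (B (r k) ** A (r k))) \<longlonglongrightarrow> N ** mat 1"
      using lim LIMSEQ_subseq_LIMSEQ [OF M1 r] by (intro bb) (simp_all add: o_def)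
    then show "(\<lambda>k. T (r k) ** (B (r k) ** A (r k))) \<longlonglongrightarrow> N" by simp
    fix k
    have "T (r k) ** (B (r k) ** A (r k)) = (1 / e (r k)) *\<^sub>R ring_commutator (A (r k)) (B (r k))"
      unfolding T_def by (simp add: bounded_bilinear.scaleR_left [OF bounded_bilinear_matrix_mult]
          KM ring_commutator_def)
    moreover have "spectrum (ring_commutator (A (r k)) (B (r k))) \<subseteq> \<real>" using real_spec AB by blast
    ultimately show "spectrum (T (r k) ** (B (r k) ** A (r k))) \<subseteq> \<real>"
      using spectrum_scaleR_real [of _ "1 / e (r k)"] e [of "r k", THEN order_less_imp_not_eq2] by simp
  qed
  have "N = 0"
  proof (rule tangent_trivial)
    show "(K \<circ> r) k \<in> G" "(e \<circ> r) k > 0" for k using KG e by auto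
    show "(e \<circ> r) \<longlonglongrightarrow> 0" using LIMSEQ_subseq_LIMSEQ [OF e0 r] .
    show "(\<lambda>k. (1 / (e \<circ> r) k) *\<^sub>R ((K \<circ> r) k - mat 1)) \<longlonglongrightarrow> N"
      using lim by (simp add: T_def o_def)
  qed (rule real)
  then show False using N by simp
qed

text \<open>If \<open>B\<close> is close to 1, then so is its conjugate \<open>B' = A B A\<inverse>\<close>; they commute, and \<open>B'\<^sup>2 = B\<^sup>2\<close>. Then
  \<open>T = B' B\<inverse>\<close> satisfies \<open>T\<^sup>2 = 1\<close>, and it is too close to 1 to have the eigenvalue \<open>-1\<close>.\<close>

lemma central_near_identity:
  obtains \<delta> where "\<delta> > 0" "\<And>A B. A \<in> G \<Longrightarrow> B \<in> G \<Longrightarrow> norm (B - mat 1) < \<delta> \<Longrightarrow> A ** B = B ** A"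
proof -
  obtain \<delta>0 where \<delta>0: "\<delta>0 > 0"
    "\<And>A B. A \<in> G \<Longrightarrow> B \<in> G \<Longrightarrow> norm (A - mat 1) < \<delta>0 \<Longrightarrow> norm (B - mat 1) < \<delta>0 \<Longrightarrow> A ** B = B ** A"
    using commute_near_identity by blast
  obtain R0 where R0: "R0 > 0" "\<And>A. A \<in> G \<Longrightarrow> norm A \<le> R0" using norm_bound by blast
  define R where "R = max R0 1"
  have R: "R \<ge> 1" "\<And>A. A \<in> G \<Longrightarrow> norm A \<le> R" using R0 by (auto simp: R_def le_max_iff_disj)
  (* Two factors R keep the conjugate B close to 1, a third one keeps T at distance less than 2 from 1. *)
  define \<delta> where "\<delta> = min \<delta>0 1 / (R * R * R)"
  have R3: "R * R \<ge> 1" "R * R * R \<ge> 1" "R * R * R > 0"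
  proof -
    show 1: "R * R \<ge> 1" using mult_mono [of 1 R 1 R] R(1) by simp
    show "R * R * R \<ge> 1" using mult_mono [of 1 "R * R" 1 R] R(1) 1 by simp
    then show "R * R * R > 0" by simp
  qed
  have \<delta>: "\<delta> > 0" using \<delta>0 R3 by (simp add: \<delta>_def)
  have \<delta>R: "\<delta> * (R * R * R) = min \<delta>0 1" using R(1) by (simp add: \<delta>_def)
  have \<delta>R2: "\<delta> * (R * R) \<le> min \<delta>0 1"
  proof -
    have "\<delta> * (R * R) * 1 \<le> \<delta> * (R * R) * R" using R(1) \<delta> by (intro mult_left_mono) auto
    also have "\<dots> = min \<delta>0 1" using \<delta>R by (simp only: mult.assoc)
    finally show ?thesis by simp
  qed
  have \<delta>1: "\<delta> \<le> min \<delta>0 1"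
  proof -
    have "\<delta> * 1 \<le> \<delta> * (R * R)" using R3 \<delta> by (intro mult_left_mono) auto
    then show ?thesis using \<delta>R2 by simp
  qed
  have "A ** B = B ** A" if A: "A \<in> G" and B: "B \<in> G" and near: "norm (B - mat 1) < \<delta>" for A B
  proof -
    define B' where "B' = A ** B ** matrix_inv A"
    have B'G: "B' \<in> G" using A B by (simp add: B'_def)
    have "B' - mat 1 = A ** (B - mat 1) ** matrix_inv A"
      using A by (simp add: B'_def bounded_bilinear.diff_right [OF bounded_bilinear_matrix_mult]
          bounded_bilinear.diff_left [OF bounded_bilinear_matrix_mult])
    then have "norm (B' - mat 1) \<le> norm (A ** (B - mat 1)) * norm (matrix_inv A)"
      using norm_matrix_mult_le by metis
    also have "\<dots> \<le> (R * norm (B - mat 1)) * R"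
    proof (intro mult_mono)
      show "norm (A ** (B - mat 1)) \<le> R * norm (B - mat 1)"
        using norm_matrix_mult_le [of A "B - mat 1"] R(2) [OF A]
          mult_right_mono [of "norm A" R "norm (B - mat 1)"] by simp
    qed (use A R in auto)
    also have "\<dots> = norm (B - mat 1) * (R * R)" by simp
    also have lt: "\<dots> < \<delta> * (R * R)" using near R3 by (intro mult_strict_right_mono) auto
    finally have B'near: "norm (B' - mat 1) < \<delta> * (R * R)" .
    have comm: "B' ** B = B ** B'"
      using \<delta>0(2) [OF B'G B] B'near near \<delta>R2 \<delta>1 by linarith
    have sq: "B' ** B' = B ** B"
      using square_eq_if_conjugate_commutes [OF A B B'_def comm] .
    define T where "T = B' ** matrix_inv B"
    have "T ** T = mat 1"
    proof -
      have iB: "matrix_inv B ** B' = B' ** matrix_inv B"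
      proof -
        have "matrix_inv B ** B' = matrix_inv B ** (B' ** B) ** matrix_inv B"
          using B by (simp add: matrix_mul_assoc)
        also have "\<dots> = B' ** matrix_inv B" unfolding comm using B by (simp add: matrix_mul_assoc)
        finally show ?thesis .
      qed
      have "T ** T = B' ** (matrix_inv B ** B') ** matrix_inv B" by (simp add: T_def matrix_mul_assoc)
      also have "\<dots> = B' ** B' ** matrix_inv B ** matrix_inv B" unfolding iB by (simp add: matrix_mul_assoc)
      also have "\<dots> = mat 1" unfolding sq using B by simp
      finally show ?thesis .
    qed
    have "norm (T - mat 1) < 2"
    proof -
      have "T - mat 1 = (B' - B) ** matrix_inv B"
        using B by (simp add: T_def bounded_bilinear.diff_left [OF bounded_bilinear_matrix_mult])
      then have "norm (T - mat 1) \<le> norm (B' - B) * norm (matrix_inv B)"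
        using norm_matrix_mult_le by metis
      also have "\<dots> \<le> norm (B' - B) * R" using B R by (intro mult_left_mono) auto
      also have "norm (B' - B) \<le> norm (B' - mat 1) + norm (B - mat 1)"
        using norm_triangle_ineq4 [of "B' - mat 1" "B - mat 1"] by simp
      also have "norm (B' - mat 1) + norm (B - mat 1) < \<delta> * (R * R) + \<delta> * (R * R)"
        using B'near near mult_left_mono [of 1 "R * R" \<delta>] R3 \<delta> by linarith
      finally have "norm (T - mat 1) < (\<delta> * (R * R) + \<delta> * (R * R)) * R"
        using R by (auto simp: mult_strict_right_mono intro: le_less_trans)
      also have "\<dots> = 2 * (\<delta> * (R * R * R))" by (simp add: algebra_simps)
      finally show ?thesis using \<delta>R by linarith
    qed
    have "T *v v = v" for v
    proof (rule ccontr)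
      assume "T *v v \<noteq> v"
      define w where "w = T *v v - v"
      have w: "w \<noteq> 0" using \<open>T *v v \<noteq> v\<close> by (simp add: w_def)
      have "T *v w = - w"
        using \<open>T ** T = mat 1\<close>
        by (simp add: w_def matrix_vector_mult_diff_distrib matrix_vector_mul_assoc)
      then have "(T - mat 1) *v w = (-2) *s w"
        by (simp add: matrix_vector_mult_diff_rdistrib vec_eq_iff)
      then have "2 * norm w \<le> norm (T - mat 1) * norm w"
        using norm_matrix_vector_le [of "T - mat 1" w] by (simp add: norm_vector_scale)
      then show False using w \<open>norm (T - mat 1) < 2\<close> by simp
    qed
    then have "T = mat 1" by (simp add: matrix_eq)
    then have "B' = B" using B inv_mult(4) [OF B, of B'] by (simp add: T_def)
    then have "A ** B ** matrix_inv A ** A = B ** A" by (simp add: B'_def)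
    then show ?thesis using A by simp
  qed
  then show ?thesis using that \<delta> by blast
qed

lemma finite_modulo_scalars:
  assumes irr: "irreducible_matrices G"
  obtains F where "finite F" "F \<subseteq> G" "\<And>B. B \<in> G \<Longrightarrow> \<exists>f\<in>F. \<exists>c. B = smul c f"
proof -
  obtain \<delta> where \<delta>: "\<delta> > 0"
    "\<And>A B. A \<in> G \<Longrightarrow> B \<in> G \<Longrightarrow> norm (B - mat 1) < \<delta> \<Longrightarrow> A ** B = B ** A"
    using central_near_identity by blast
  obtain R where R: "R > 0" "\<And>A. A \<in> G \<Longrightarrow> norm A \<le> R" using norm_bound by blast
  have "G \<subseteq> (\<Union>f\<in>G. ball f (\<delta> / R))" using \<delta> R by force
  then obtain F where F: "F \<subseteq> G" "finite F" "G \<subseteq> (\<Union>f\<in>F. ball f (\<delta> / R))"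
    using compactE_image [OF cpt, of G "\<lambda>f. ball f (\<delta> / R)"] by (metis open_ball)
  have "\<exists>f\<in>F. \<exists>c. B = smul c f" if B: "B \<in> G" for B
  proof -
    obtain f where f: "f \<in> F" "f \<in> G" "dist f B < \<delta> / R" using subsetD [OF F(3) B] F(1) by auto
    let ?Z = "matrix_inv f ** B"
    have "?Z - mat 1 = matrix_inv f ** (B - f)"
      using f by (simp add: bounded_bilinear.diff_right [OF bounded_bilinear_matrix_mult])
    then have "norm (?Z - mat 1) \<le> norm (matrix_inv f) * norm (B - f)"
      using norm_matrix_mult_le by metis
    also have "\<dots> \<le> R * norm (B - f)" using f R by (intro mult_right_mono) auto
    also have "\<dots> < \<delta>" using f(3) R(1) by (simp add: dist_norm norm_minus_commute pos_less_divide_eq mult.commute)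
    finally have near: "norm (?Z - mat 1) < \<delta>" .
    have "?Z ** A = A ** ?Z" if "A \<in> G" for A
      using \<delta>(2) [OF that _ near] f B by simp
    then obtain c where "?Z = mat c" using commuting_with_irreducible_is_scalar [OF irr] by metis
    then have "f ** ?Z = smul c f" by (simp add: mat_eq_smul [of c])
    moreover have "f ** ?Z = B" using f by (simp add: matrix_mul_assoc)
    ultimately show ?thesis using f by auto
  qed
  then show ?thesis using that F by blast
qed

end

section \<open>Conjugates of a matrix group\<close>

lemma matrix_inv_unique:
  fixes A B :: "'a::field ^ 'n ^ 'n"
  assumes "A ** B = mat 1"
  shows "matrix_inv A = B"
proof -
  have BA: "B ** A = mat 1" using assms by (simp add: matrix_left_right_inverse)
  then have "invertible A" using assms by (auto simp: invertible_def)
  then have "matrix_inv A ** (A ** B) = B"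
    by (simp add: matrix_mul_assoc matrix_inv_mult)
  then show ?thesis by (simp add: assms)
qed

lemma matrix_group_conjugate:
  fixes G :: "('a::field ^ 'n ^ 'n) set"
  assumes G: "matrix_group G" and P: "invertible P"
  shows "matrix_group (conjugate_by P G)"
proof -
  note Pi = matrix_inv_mult [OF P]
  have cancel: "X ** P ** matrix_inv P = X" "X ** matrix_inv P ** P = X" for X
    by (simp_all add: matrix_mul_assoc [symmetric] Pi)
  have mult: "matrix_inv P ** A ** P ** (matrix_inv P ** B ** P) = matrix_inv P ** (A ** B) ** P" for A B
    by (simp add: matrix_mul_assoc cancel)
  have inverse: "matrix_inv P ** A ** P ** (matrix_inv P ** matrix_inv A ** P) = mat 1"
    "matrix_inv (matrix_inv P ** A ** P) = matrix_inv P ** matrix_inv A ** P"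
    "invertible (matrix_inv P ** A ** P)" if "A \<in> G" for A
  proof -
    have A: "invertible A" using G that by (simp add: matrix_group_def)
    show 1: "matrix_inv P ** A ** P ** (matrix_inv P ** matrix_inv A ** P) = mat 1"
      by (simp add: mult matrix_inv_mult [OF A] Pi)
    then show "matrix_inv (matrix_inv P ** A ** P) = matrix_inv P ** matrix_inv A ** P"
      by (rule matrix_inv_unique)
    show "invertible (matrix_inv P ** A ** P)"
      using 1 by (metis invertible_right_inverse)
  qed
  have one: "mat 1 \<in> conjugate_by P G"
    unfolding conjugate_by_def
    by (rule rev_image_eqI [of "mat 1"]) (use G in \<open>simp_all add: matrix_group_def Pi\<close>)
  show ?thesis
    unfolding matrix_group_def
  proof (intro conjI ballI one)
    show "invertible X" if "X \<in> conjugate_by P G" for X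
      using that inverse(3) by (auto simp: conjugate_by_def)
    show "matrix_inv X \<in> conjugate_by P G" if "X \<in> conjugate_by P G" for X
      using that G by (auto simp: conjugate_by_def inverse(2) matrix_group_def)
    show "X ** Y \<in> conjugate_by P G" if "X \<in> conjugate_by P G" "Y \<in> conjugate_by P G" for X Y
      using that G by (auto simp: conjugate_by_def mult matrix_group_def)
  qed
qed

lemma matrix_vector_axis: "A *v axis j 1 = column j A" for A :: "'a::comm_ring_1 ^ 'n ^ 'm"
proof -
  have "(\<Sum>k\<in>UNIV. A $ i $ k * axis j 1 $ k) = (\<Sum>k\<in>UNIV. if k = j then A $ i $ k else 0)" for i
    by (intro sum.cong) (auto simp: axis_def)
  then show ?thesis by (simp add: matrix_vector_mult_def column_def vec_eq_iff)
qed

section \<open>Group commutators are commuting involutions\<close>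

locale irreducible_commutator_group = compact_commutator_group G
  for G :: "(complex ^ 'n ^ 'n) set" +
  assumes irr: "irreducible_matrices G"
begin

text \<open>Conditions (a) and (b) are insensitive to scalar factors. Normalising the determinant makes the
  group finite; the scalars used here need not belong to \<open>G\<close>.\<close>

definition G1 :: "(complex ^ 'n ^ 'n) set" where
  "G1 = {X. \<exists>A\<in>G. \<exists>c. X = smul c A \<and> det X = 1}"

definition M1 :: "(complex ^ 'n ^ 'n) monoid" where
  "M1 = \<lparr>carrier = G1, monoid.mult = (**), one = mat 1\<rparr>"

lemma G1E:
  assumes "X \<in> G1"
  obtains A c where "A \<in> G" "c \<noteq> 0" "X = smul c A" "det X = 1"
proof -
  obtain A c where Ac: "A \<in> G" "X = smul c A" "det X = 1" using assms by (auto simp: G1_def)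
  have "c \<noteq> 0"
  proof
    assume "c = 0"
    then have "det X = 0" using Ac(2) by (simp add: det_smul)
    then show False using Ac(3) by simp
  qed
  then show ?thesis using that Ac by blast
qed

lemma G1_mult: "X \<in> G1 \<Longrightarrow> Y \<in> G1 \<Longrightarrow> X ** Y \<in> G1"
proof -
  assume "X \<in> G1" "Y \<in> G1"
  then obtain A c B d where AB: "A \<in> G" "X = smul c A" "det X = 1" "B \<in> G" "Y = smul d B" "det Y = 1"
    by (elim G1E) blast
  have "det (X ** Y) = 1" using AB(3,6) by (simp add: det_mul)
  moreover have "X ** Y = smul (d * c) (A ** B)" "A ** B \<in> G" using AB by simp_all
  ultimately show ?thesis unfolding G1_def by blast
qed

lemma G1_inverse:
  assumes A: "A \<in> G" and c: "c \<noteq> 0" and det: "det (smul c A) = 1"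
  shows "smul (1 / c) (matrix_inv A) \<in> G1"
    "smul (1 / c) (matrix_inv A) ** smul c A = mat 1"
proof -
  show 1: "smul (1 / c) (matrix_inv A) ** smul c A = mat 1" using A c by simp
  have "det (smul (1 / c) (matrix_inv A)) * det (smul c A) = 1"
    unfolding det_mul [symmetric] 1 by simp
  then have "det (smul (1 / c) (matrix_inv A)) = 1" using det by simp
  then show "smul (1 / c) (matrix_inv A) \<in> G1" using inv_in [OF A] unfolding G1_def by blast
qed

lemma group_M1: "group M1"
proof (rule groupI)
  show "X \<otimes>\<^bsub>M1\<^esub> Y \<in> carrier M1" if "X \<in> carrier M1" "Y \<in> carrier M1" for X Y
    using that by (simp add: M1_def G1_mult)
  have "mat 1 = smul 1 (mat 1 :: complex ^ 'n ^ 'n)" "det (mat 1 :: complex ^ 'n ^ 'n) = 1" by simp_all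
  then have "mat 1 \<in> G1" unfolding G1_def using one_in by blast
  then show "\<one>\<^bsub>M1\<^esub> \<in> carrier M1" by (simp add: M1_def)
  show "X \<otimes>\<^bsub>M1\<^esub> Y \<otimes>\<^bsub>M1\<^esub> Z = X \<otimes>\<^bsub>M1\<^esub> (Y \<otimes>\<^bsub>M1\<^esub> Z)" for X Y Z
    by (simp add: M1_def matrix_mul_assoc)
  show "\<one>\<^bsub>M1\<^esub> \<otimes>\<^bsub>M1\<^esub> X = X" for X by (simp add: M1_def)
  show "\<exists>Y\<in>carrier M1. Y \<otimes>\<^bsub>M1\<^esub> X = \<one>\<^bsub>M1\<^esub>" if X: "X \<in> carrier M1" for X
  proof -
    obtain A c where A: "A \<in> G" "c \<noteq> 0" "X = smul c A" "det X = 1"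
      using X by (auto simp: M1_def elim: G1E)
    have inv: "smul (1 / c) (matrix_inv A) \<in> G1" "smul (1 / c) (matrix_inv A) ** X = mat 1"
      using G1_inverse [of A c] A by blast+
    then show ?thesis unfolding M1_def by (intro bexI [of _ "smul (1 / c) (matrix_inv A)"]) simp_all
  qed
qed

lemma inv_M1:
  assumes A: "A \<in> G" and c: "c \<noteq> 0" and det: "det (smul c A) = 1"
  shows "inv\<^bsub>M1\<^esub> (smul c A) = smul (1 / c) (matrix_inv A)"
proof (rule group.inv_equality [OF group_M1])
  show "smul (1 / c) (matrix_inv A) \<otimes>\<^bsub>M1\<^esub> smul c A = \<one>\<^bsub>M1\<^esub>"
    using G1_inverse(2) [OF assms] by (simp add: M1_def)
  show "smul (1 / c) (matrix_inv A) \<in> carrier M1" using G1_inverse(1) [OF assms] by (simp add: M1_def)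
  show "smul c A \<in> carrier M1" using A det by (auto simp: M1_def G1_def)
qed

lemma cj_M1:
  assumes "A \<in> G" "c \<noteq> 0" "det (smul c A) = 1"
  shows "group.cj M1 (smul c A) (smul d B) = smul d (A ** B ** matrix_inv A)"
  using assms(2) unfolding group.cj_def [OF group_M1] inv_M1 [OF assms] by (simp add: M1_def)

lemma finite_G1: "finite G1"
proof -
  obtain F where F: "finite F" "F \<subseteq> G" "\<And>B. B \<in> G \<Longrightarrow> \<exists>f\<in>F. \<exists>c. B = smul c f"
    using finite_modulo_scalars [OF irr] by blast
  have "G1 \<subseteq> (\<Union>f\<in>F. (\<lambda>w. smul w f) ` {w. w ^ CARD('n) = 1 / det f})"
  proof
    fix X assume "X \<in> G1"
    then obtain A c where A: "A \<in> G" "X = smul c A" "det X = 1" by (auto simp: G1_def)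
    obtain f d where f: "f \<in> F" "A = smul d f" using F(3) [OF A(1)] by blast
    have X: "X = smul (c * d) f" using A f by simp
    then have "(c * d) ^ CARD('n) * det f = 1" using A(3) by (simp add: det_smul)
    then have "(c * d) ^ CARD('n) = 1 / det f"
      by (metis mult_zero_right nonzero_eq_divide_eq zero_neq_one)
    then show "X \<in> (\<Union>f\<in>F. (\<lambda>w. smul w f) ` {w. w ^ CARD('n) = 1 / det f})"
      using f(1) X by blast
  qed
  moreover have "finite {w :: complex. w ^ CARD('n) = a}" for a
    by (rule finite_nth_roots) simp
  ultimately show ?thesis using F(1) by (meson finite_UN_I finite_imageI finite_subset)
qed

lemma rigid_M1: "rigid_group M1"
proof -
  interpret M: group M1 by (rule group_M1)
  show ?thesis
  proof
    show "finite (carrier M1)" using finite_G1 by (simp add: M1_def)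
  next
    fix X Y assume X: "X \<in> carrier M1" and Y: "Y \<in> carrier M1"
      and comm: "M.cj X Y \<otimes>\<^bsub>M1\<^esub> Y = Y \<otimes>\<^bsub>M1\<^esub> M.cj X Y"
    obtain A c where A: "A \<in> G" "c \<noteq> 0" "X = smul c A" "det X = 1"
      using X by (auto simp: M1_def elim: G1E)
    obtain B d where B: "B \<in> G" "d \<noteq> 0" "Y = smul d B" "det Y = 1"
      using Y by (auto simp: M1_def elim: G1E)
    have "smul (d * d) (A ** B ** matrix_inv A ** B) = smul (d * d) (B ** (A ** B ** matrix_inv A))"
      using comm cj_M1 [of A c d B] A B by (simp add: M1_def)
    then have "A ** B ** matrix_inv A ** B = B ** (A ** B ** matrix_inv A)"
      using B(2) by (simp add: smul_left_cancel)
    then have "A ** (B ** B) = B ** B ** A" by (rule commutes_with_square [OF A(1) B(1)])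
    then show "X \<otimes>\<^bsub>M1\<^esub> (Y \<otimes>\<^bsub>M1\<^esub> Y) = Y \<otimes>\<^bsub>M1\<^esub> Y \<otimes>\<^bsub>M1\<^esub> X"
      using A B by (simp add: M1_def mult_ac)
  next
    fix X Y K assume X: "X \<in> carrier M1" and Y: "Y \<in> carrier M1"
      and K: "K = M.cj X Y \<otimes>\<^bsub>M1\<^esub> inv\<^bsub>M1\<^esub> Y"
      and KX: "K \<otimes>\<^bsub>M1\<^esub> X = X \<otimes>\<^bsub>M1\<^esub> K" and KY: "K \<otimes>\<^bsub>M1\<^esub> Y = Y \<otimes>\<^bsub>M1\<^esub> K"
    obtain A c where A: "A \<in> G" "c \<noteq> 0" "X = smul c A" "det X = 1"
      using X by (auto simp: M1_def elim: G1E)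
    obtain B d where B: "B \<in> G" "d \<noteq> 0" "Y = smul d B" "det Y = 1"
      using Y by (auto simp: M1_def elim: G1E)
    have K': "K = A ** B ** matrix_inv A ** matrix_inv B"
      using K cj_M1 [of A c d B] inv_M1 [of B d] A B by (simp add: M1_def)
    have "K ** A = A ** K" "K ** B = B ** K"
      using KX KY A B by (simp_all add: M1_def smul_left_cancel)
    then have "K = mat 1" by (rule central_commutator_trivial [OF A(1) B(1) K'])
    then show "K = \<one>\<^bsub>M1\<^esub>" by (simp add: M1_def)
  qed
qed

text \<open>The determinant is prescribed so that these involutions are members both of \<open>G\<close> and of \<open>G1\<close>; group
  commutators have determinant 1 anyway.\<close>

definition D :: "(complex ^ 'n ^ 'n) set" where
  "D = {X \<in> G. det X = 1 \<and> X ** X = mat 1}"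

lemma D_G: "X \<in> D \<Longrightarrow> X \<in> G" by (simp add: D_def)

lemma D_sq: "X \<in> D \<Longrightarrow> X ** X = mat 1" by (simp add: D_def)

lemma D_commute:
  assumes "X \<in> D" "Y \<in> D"
  shows "X ** Y = Y ** X"
proof -
  interpret M: rigid_group M1 by (rule rigid_M1)
  have "X \<in> M.invols" if "X \<in> D" for X
  proof -
    have "X = smul 1 X" by simp
    then have "X \<in> G1" using that unfolding D_def G1_def by blast
    then show ?thesis using that by (simp add: M.invols_def) (simp add: M1_def D_def)
  qed
  then have "X \<otimes>\<^bsub>M1\<^esub> Y = Y \<otimes>\<^bsub>M1\<^esub> X" using M.invols_comm assms by blast
  then show ?thesis by (simp add: M1_def)
qed

lemma D_conjugate:
  assumes A: "A \<in> G" and X: "X \<in> D"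
  shows "A ** X ** matrix_inv A \<in> D"
proof -
  have "A ** X ** matrix_inv A ** (A ** X ** matrix_inv A) = A ** (X ** X) ** matrix_inv A"
    using A by (simp add: matrix_mul_assoc)
  also have "\<dots> = mat 1" using A by (simp add: D_sq [OF X])
  finally have "A ** X ** matrix_inv A ** (A ** X ** matrix_inv A) = mat 1" .
  moreover have "det (A ** X ** matrix_inv A) = 1"
  proof -
    have "det (A ** X ** matrix_inv A) = det X * det (A ** matrix_inv A)"
      by (simp only: det_mul mult_ac)
    then show ?thesis using A X by (simp add: D_def)
  qed
  ultimately show ?thesis using A X by (simp add: D_def)
qed

text \<open>The commutator is unchanged when \<open>A\<close> and \<open>B\<close> are rescaled to determinant 1.\<close>

lemma commutator_in_D:
  assumes A: "A \<in> G" and B: "B \<in> G"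
  shows "A ** B ** matrix_inv A ** matrix_inv B \<in> D" (is "?K \<in> D")
proof -
  interpret M: rigid_group M1 by (rule rigid_M1)
  have det0: "det X \<noteq> 0" if "X \<in> G" for X
    using that grp by (simp add: matrix_group_def invertible_det_nz [symmetric])
  have root: "\<exists>c. c \<noteq> 0 \<and> det (smul c X) = 1" if X: "X \<in> G" for X
  proof -
    obtain c where c: "1 / det X = c ^ CARD('n)"
      by (rule exists_complex_root [of "CARD('n)" "1 / det X"]) simp_all
    have "det (smul c X) = 1" using det0 [OF X] by (simp add: det_smul c [symmetric])
    moreover have "c \<noteq> 0" using c det0 [OF X] by (auto simp: power_0_left)
    ultimately show ?thesis by blast
  qed
  obtain c where c: "c \<noteq> 0" "det (smul c A) = 1" using root [OF A] by blast
  obtain d where d: "d \<noteq> 0" "det (smul d B) = 1" using root [OF B] by blast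
  have in1: "smul c A \<in> carrier M1" "smul d B \<in> carrier M1"
    using A B c d by (auto simp: M1_def G1_def)
  have "M.cj (smul c A) (smul d B) \<otimes>\<^bsub>M1\<^esub> inv\<^bsub>M1\<^esub> (smul d B) \<in> M.invols"
    by (rule M.commutator_involution [OF in1])
  moreover have "M.cj (smul c A) (smul d B) \<otimes>\<^bsub>M1\<^esub> inv\<^bsub>M1\<^esub> (smul d B) = ?K"
    using c d by (simp add: cj_M1 [OF A c] inv_M1 [OF B d]) (simp add: M1_def)
  ultimately have "?K ** ?K = mat 1" "det ?K = 1"
    by (auto simp: M.invols_def) (auto simp: M1_def elim: G1E)
  then show ?thesis using A B by (simp add: D_def)
qed

section \<open>The monomial basis\<close>

lemma matrix_inv_inv: "A \<in> G \<Longrightarrow> matrix_inv (matrix_inv A) = A"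
  by (intro matrix_inv_unique) simp

lemma D_conjugate': "A \<in> G \<Longrightarrow> X \<in> D \<Longrightarrow> matrix_inv A ** X ** A \<in> D"
  using D_conjugate [of "matrix_inv A" X] by (simp add: matrix_inv_inv)

text \<open>Let \<open>\<mu>\<close> be the character of \<open>D\<close> on a common eigenvector, \<open>V\<close> its weight space, and \<open>H\<close> the stabiliser of
  \<open>\<mu>\<close>, a normal subgroup since it contains the commutators. On \<open>V\<close> members of \<open>H\<close> commute up to the
  scalar \<open>\<mu>\<close> of their commutator, hence commute, and have a common eigenvector \<open>v\<close>, with character \<open>l\<close>.
  If \<open>l h\<close> is not \<open>\<plusminus>1\<close>, then \<open>conjugate_eigenvalues\<close> makes \<open>h\<close> act by the same scalar on the whole orbit of
  \<open>v\<close>; multiplying \<open>h\<close> by a nonscalar member of \<open>D\<close> rules this out. Finally choose a basis \<open>Bs\<close> in the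
  orbit. An orbit vector has the same weight as some member \<open>b\<close> of \<open>Bs\<close> that occurs in its expansion, so
  it is obtained from \<open>b\<close> by a conjugate of a member of \<open>H\<close>, that is, up to sign it is \<open>b\<close>.\<close>

lemma monomial_basis:
  assumes n: "CARD('n) \<ge> 2"
  obtains b :: "'n \<Rightarrow> complex ^ 'n"
  where "vec.span (range b) = UNIV" "inj b" "\<And>j k. b j \<noteq> - b k"
    "\<And>A j. A \<in> G \<Longrightarrow> \<exists>k. A *v b j = b k \<or> A *v b j = - b k"
    "\<And>X j. X \<in> D \<Longrightarrow> X *v b j = b j \<or> X *v b j = - b j"
proof -
  have nt: "(UNIV :: (complex ^ 'n) set) \<noteq> {0}"
  proof -
    have "(axis undefined 1 :: complex ^ 'n) \<noteq> 0" by (simp add: axis_eq_0_iff)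
    then show ?thesis by blast
  qed
  have "\<exists>v\<in>UNIV. v \<noteq> 0 \<and> (\<forall>X\<in>D. \<exists>c. X *v v = c *s v)"
    by (rule common_eigenvector [OF vec.subspace_UNIV nt])
      (simp_all add: matrix_vector_mul_assoc D_commute)
  then obtain v0 where v0: "v0 \<noteq> 0" "\<forall>X\<in>D. \<exists>c. X *v v0 = c *s v0" by blast
  then obtain \<mu> where \<mu>: "\<And>X. X \<in> D \<Longrightarrow> X *v v0 = \<mu> X *s v0" by metis
  define V where "V = {v. \<forall>X\<in>D. X *v v = \<mu> X *s v}"
  have V: "vec.subspace V"
    unfolding V_def by (rule vec.subspaceI)
      (simp_all add: matrix_vector_right_distrib vec.scale_right_distrib vec.scale mult.commute)
  have "v0 \<in> V" using \<mu> by (simp add: V_def)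
  then have Vnz: "V \<noteq> {0}" using v0 by blast
  define H where "H = {A \<in> G. \<forall>X\<in>D. \<mu> (matrix_inv A ** X ** A) = \<mu> X}"
  have HG: "A \<in> G" if "A \<in> H" for A using that by (simp add: H_def)
  have H_V: "A *v v \<in> V" if A: "A \<in> H" and v: "v \<in> V" for A v
  proof -
    have "X *v (A *v v) = \<mu> X *s (A *v v)" if X: "X \<in> D" for X
    proof -
      let ?Y = "matrix_inv A ** X ** A"
      have Y: "?Y \<in> D" using D_conjugate' [OF HG [OF A] X] .
      have "X ** A = A ** ?Y" using HG [OF A] by (simp add: matrix_mul_assoc)
      then have "X *v (A *v v) = A *v (?Y *v v)" by (simp only: matrix_vector_mul_assoc)
      also have "?Y *v v = \<mu> ?Y *s v" using v Y by (simp add: V_def)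
      also have "\<mu> ?Y = \<mu> X" using A X by (simp add: H_def)
      finally show ?thesis by (simp add: vec.scale)
    qed
    then show ?thesis by (simp add: V_def)
  qed
  have DH: "X \<in> H" if X: "X \<in> D" for X
  proof -
    have "matrix_inv X ** Y ** X = Y" if Y: "Y \<in> D" for Y
    proof -
      have "matrix_inv X ** Y ** X = matrix_inv X ** (X ** Y)"
        by (simp add: matrix_mul_assoc D_commute [OF X Y, symmetric]) (simp add: D_commute [OF X Y] matrix_mul_assoc [symmetric])
      then show ?thesis using D_G [OF X] by (simp add: matrix_mul_assoc)
    qed
    then show ?thesis using D_G [OF X] by (simp add: H_def)
  qed
  have H_mult: "A ** B \<in> H" if A: "A \<in> H" and B: "B \<in> H" for A B
  proof -
    have inv: "matrix_inv (A ** B) = matrix_inv B ** matrix_inv A"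
      using HG [OF A] HG [OF B] by (intro matrix_inv_unique) (simp add: matrix_mul_assoc)
    have "\<mu> (matrix_inv (A ** B) ** X ** (A ** B)) = \<mu> X" if X: "X \<in> D" for X
    proof -
      have Y: "matrix_inv A ** X ** A \<in> D" using D_conjugate' [OF HG [OF A] X] .
      have "matrix_inv (A ** B) ** X ** (A ** B) = matrix_inv B ** (matrix_inv A ** X ** A) ** B"
        by (simp add: inv matrix_mul_assoc)
      then show ?thesis using A B X Y by (simp add: H_def)
    qed
    then show ?thesis using A B by (simp add: H_def)
  qed
  have H_conj: "matrix_inv A ** h ** A \<in> H" if A: "A \<in> G" and h: "h \<in> H" for A h
  proof -
    have "matrix_inv A ** h ** matrix_inv (matrix_inv A) ** matrix_inv h \<in> D"
      using A HG [OF h] by (intro commutator_in_D) auto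
    from H_mult [OF DH [OF this] h]
    have "matrix_inv A ** h ** A ** matrix_inv h ** h \<in> H"
      using A by (simp add: matrix_inv_inv)
    then show ?thesis using HG [OF h] by simp
  qed
  have H_comm: "A *v (B *v w) = B *v (A *v w)" if A: "A \<in> H" and B: "B \<in> H" and w: "w \<in> V" for A B w
  proof -
    let ?K = "A ** B ** matrix_inv A ** matrix_inv B"
    have K: "?K \<in> D" using HG A B by (intro commutator_in_D) auto
    have AB: "A ** B = ?K ** (B ** A)" using HG [OF A] HG [OF B] by (simp add: matrix_mul_assoc)
    have tw: "A *v (B *v w) = \<mu> ?K *s (B *v (A *v w))" if w: "w \<in> V" for w
    proof -
      have "?K *v (B *v (A *v w)) = (?K ** (B ** A)) *v w"
        by (simp only: matrix_vector_mul_assoc matrix_mul_assoc)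
      also have "\<dots> = A *v (B *v w)" by (simp only: AB [symmetric] matrix_vector_mul_assoc)
      finally have "A *v (B *v w) = ?K *v (B *v (A *v w))" by simp
      moreover have "B *v (A *v w) \<in> V" using H_V A B w by blast
      ultimately show ?thesis using K by (simp add: V_def)
    qed
    have "\<mu> ?K = 1"
      using H_V [OF A] H_V [OF B] tw by (rule no_twisted_commutation [OF HG [OF A] HG [OF B] V Vnz])
    then show ?thesis using tw [OF w] by simp
  qed
  have "\<exists>v\<in>V. v \<noteq> 0 \<and> (\<forall>h\<in>H. \<exists>c. h *v v = c *s v)"
    using V Vnz H_V H_comm by (rule common_eigenvector)
  then obtain v where v: "v \<in> V" "v \<noteq> 0" "\<forall>h\<in>H. \<exists>c. h *v v = c *s v" by blast
  then obtain l where l: "\<And>h. h \<in> H \<Longrightarrow> h *v v = l h *s v" by metis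
  have l_D: "l X = \<mu> X" if "X \<in> D" for X
  proof -
    have "l X *s v = \<mu> X *s v" using l [OF DH [OF that]] v(1) that by (auto simp: V_def)
    then show ?thesis using v(2) by auto
  qed
  have h_orbit: "h *v (A *v v) = l (matrix_inv A ** h ** A) *s (A *v v)" if A: "A \<in> G" and h: "h \<in> H" for A h
  proof -
    have "h ** A = A ** (matrix_inv A ** h ** A)" using A by (simp add: matrix_mul_assoc)
    then have "h *v (A *v v) = A *v ((matrix_inv A ** h ** A) *v v)" by (simp only: matrix_vector_mul_assoc)
    also have "\<dots> = l (matrix_inv A ** h ** A) *s (A *v v)"
      using l [OF H_conj [OF A h]] by (simp add: vec.scale)
    finally show ?thesis .
  qed
  define Ob where "Ob = (\<lambda>A. A *v v) ` G"
  have Ob_nz: "w \<noteq> 0" if "w \<in> Ob" for w using that v(2) by (auto simp: Ob_def)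
  have v_Ob: "v \<in> Ob" unfolding Ob_def by (rule rev_image_eqI [OF one_in]) simp
  have spanO: "vec.span Ob = UNIV"
  proof -
    have "A *v w \<in> vec.span Ob" if A: "A \<in> G" and w: "w \<in> vec.span Ob" for A w
      using w
    proof (induction rule: vec.span_induct_alt)
      case base then show ?case by (simp add: vec.span_zero)
    next
      case (step c x y)
      obtain B where "B \<in> G" "x = B *v v" using step by (auto simp: Ob_def)
      then have "A *v x \<in> Ob" using A by (auto simp: Ob_def matrix_vector_mul_assoc)
      then show ?case using step
        by (simp add: matrix_vector_right_distrib vec.scale vec.span_add vec.span_scale vec.span_base)
    qed
    then have "vec.span Ob = {0} \<or> vec.span Ob = UNIV"
      using irr vec.subspace_span [of Ob] unfolding irreducible_matrices_def by blast
    moreover have "v \<in> vec.span Ob" using v_Ob by (rule vec.span_base)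
    ultimately show ?thesis using v(2) by blast
  qed
  have scalar: "h *v w = l h *s w" if h: "h \<in> H" and nr: "l h \<noteq> 1" "l h \<noteq> -1" for h w
  proof -
    have onO: "h *v x = l h *s x" if xO: "x \<in> Ob" for x
    proof -
      obtain A where A: "A \<in> G" "x = A *v v" using xO by (auto simp: Ob_def)
      have x: "x \<noteq> 0" using xO by (rule Ob_nz)
      have "(A ** h ** matrix_inv A) *v x = l h *s x"
        using A l [OF h] by (simp add: matrix_vector_mul_assoc [symmetric] vec.scale)
      from conjugate_eigenvalues [OF A(1) HG [OF h] x this] h_orbit [OF A(1) h] nr
      show ?thesis using A by auto
    qed
    have "w \<in> vec.span Ob" by (simp add: spanO)
    then show ?thesis
    proof (induction rule: vec.span_induct_alt)
      case base then show ?case by simp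
    next
      case (step c x y)
      then show ?case
        by (simp add: onO matrix_vector_right_distrib vec.scale vec.scale_right_distrib mult.commute)
    qed
  qed
  have "\<exists>A0\<in>G. A0 \<notin> H"
  proof (rule ccontr)
    assume "\<not> ?thesis"
    then have GH: "A \<in> H" if "A \<in> G" for A using that by blast
    have "Ob \<subseteq> vec.span {v}"
      unfolding Ob_def using l [OF GH] by (auto intro: vec.span_scale vec.span_base)
    then have "vec.span {v} = UNIV" using spanO vec.span_minimal vec.subspace_span by blast
    then have "vec.dim (UNIV :: (complex ^ 'n) set) \<le> card {v}"
      by (metis finite.emptyI finite_insert order_refl vec.dim_le_card)
    then show False using n by (simp add: card_cart_basis)
  qed
  then obtain A0 where A0: "A0 \<in> G" "A0 \<notin> H" by blast
  then obtain X0 where X0: "X0 \<in> D" "\<mu> (matrix_inv A0 ** X0 ** A0) \<noteq> \<mu> X0" by (auto simp: H_def)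
  have \<mu>_sign: "\<mu> X = 1 \<or> \<mu> X = -1" if X: "X \<in> D" for X
  proof -
    have "X *v (X *v v0) = v0" by (simp add: matrix_vector_mul_assoc D_sq [OF X])
    then have "(\<mu> X * \<mu> X) *s v0 = 1 *s v0" using \<mu> [OF X] by (simp add: vec.scale)
    then have "\<mu> X * \<mu> X = 1" using v0(1) by (simp only: vec.scale_cancel_right simp_thms)
    then show ?thesis by (simp add: square_eq_1_iff)
  qed
  have l_sign: "l h = 1 \<or> l h = -1" if h: "h \<in> H" for h
  proof (rule ccontr)
    assume neg: "\<not> ?thesis"
    have lh: "norm (l h) = 1" using eigenvalue_unimodular [OF HG [OF h] v(2) l [OF h]] .
    have hX: "h ** X0 \<in> H" using H_mult [OF h DH [OF X0(1)]] .
    have "l (h ** X0) *s v = (l h * l X0) *s v"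
      unfolding l [OF hX, symmetric]
      by (simp add: matrix_vector_mul_assoc [symmetric] l [OF DH [OF X0(1)]] l [OF h] vec.scale mult.commute)
    then have "l (h ** X0) = l h * l X0" using v(2) by simp
    then have nr: "l (h ** X0) \<noteq> 1" "l (h ** X0) \<noteq> -1"
      using neg \<mu>_sign [OF X0(1)] l_D [OF X0(1)] by (auto simp: minus_equation_iff [of _ 1])
    have X0w: "X0 *v w = l X0 *s w" for w
    proof -
      have "l h *s (X0 *v w) = h *v (X0 *v w)" using scalar [OF h] neg by simp
      also have "\<dots> = (l h * l X0) *s w"
        using scalar [OF hX nr] \<open>l (h ** X0) = l h * l X0\<close> by (simp add: matrix_vector_mul_assoc)
      finally have "l h *s (X0 *v w) = l h *s (l X0 *s w)" by simp
      moreover have "l h \<noteq> 0" using lh by auto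
      ultimately show ?thesis by (simp only: vec.scale_cancel_left simp_thms)
    qed
    have "X0 ** A0 = A0 ** X0"
      unfolding matrix_eq by (simp add: matrix_vector_mul_assoc [symmetric] X0w vec.scale)
    then have "matrix_inv A0 ** X0 ** A0 = matrix_inv A0 ** (A0 ** X0)" by (simp add: matrix_mul_assoc [symmetric])
    then have "matrix_inv A0 ** X0 ** A0 = X0" using A0(1) by (simp add: matrix_mul_assoc)
    then show False using X0 by simp
  qed
  obtain Bs where Bs: "Bs \<subseteq> Ob" "vec.independent Bs" "Ob \<subseteq> vec.span Bs"
    by (rule vec.maximal_independent_subset [of Ob])
  have finB: "finite Bs" using Bs(2) by (rule vec.finiteI_independent)
  have spanB: "vec.span Bs = UNIV" using Bs(3) spanO vec.span_minimal vec.subspace_span by blast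
  have wt: "X *v (A *v v) = \<mu> (matrix_inv A ** X ** A) *s (A *v v)" if "A \<in> G" "X \<in> D" for A X
    using h_orbit [OF that(1) DH [OF that(2)]] l_D [OF D_conjugate' [OF that]] by simp
  have "\<forall>x\<in>Ob. \<exists>f. \<forall>X\<in>D. X *v x = f X *s x"
  proof
    fix x assume "x \<in> Ob"
    then obtain A where "A \<in> G" "x = A *v v" by (auto simp: Ob_def)
    then show "\<exists>f. \<forall>X\<in>D. X *v x = f X *s x"
      using wt by (intro exI [of _ "\<lambda>X. \<mu> (matrix_inv A ** X ** A)"]) simp
  qed
  then obtain \<nu> where \<nu>: "\<And>x X. x \<in> Ob \<Longrightarrow> X \<in> D \<Longrightarrow> X *v x = \<nu> x X *s x"
    by metis
  have rep: "\<exists>b\<in>Bs. w = b \<or> w = -b" if w: "w \<in> Ob" for w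
  proof -
    obtain A where A: "A \<in> G" "w = A *v v" using w by (auto simp: Ob_def)
    have "w \<in> vec.span Bs" by (simp add: spanB)
    then obtain u where u: "w = (\<Sum>b\<in>Bs. u b *s b)" using vec.span_finite [OF finB] by auto
    have "\<exists>b\<in>Bs. u b \<noteq> 0"
    proof (rule ccontr)
      assume "\<not> ?thesis"
      then have "w = 0" by (simp add: u)
      then show False using Ob_nz w by blast
    qed
    then obtain b where b: "b \<in> Bs" "u b \<noteq> 0" by blast
    obtain C where C: "C \<in> G" "b = C *v v" using b Bs by (auto simp: Ob_def)
    have eqw: "\<nu> b X = \<nu> w X" if X: "X \<in> D" for X
    proof -
      let ?c = "\<nu> w X"
      have Xw: "X *v w = (\<Sum>x\<in>Bs. u x *s (X *v x))"
        by (subst u) (simp add: vec.sum vec.scale)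
      have cw: "c *s w = (\<Sum>x\<in>Bs. (c * u x) *s x)" for c
        by (subst u) (simp add: vec.scale_sum_right)
      have "(\<Sum>x\<in>Bs. (u x * (\<nu> x X - ?c)) *s x) = (\<Sum>x\<in>Bs. u x *s (X *v x) - (?c * u x) *s x)"
      proof (rule sum.cong)
        fix x assume "x \<in> Bs"
        then have "X *v x = \<nu> x X *s x" using \<nu> X Bs(1) by blast
        then show "(u x * (\<nu> x X - ?c)) *s x = u x *s (X *v x) - (?c * u x) *s x"
          by (simp add: vec.scale_left_diff_distrib right_diff_distrib mult.commute)
      qed simp
      also have "\<dots> = X *v w - ?c *s w" unfolding Xw cw by (rule sum_subtractf)
      also have "\<dots> = 0" using \<nu> [OF w X] by simp
      finally have "u b * (\<nu> b X - ?c) = 0"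
        by (rule vec.independentD [OF Bs(2) finB order_refl _ b(1)])
      then show ?thesis using b(2) by simp
    qed
    let ?h = "matrix_inv C ** A"
    have CA: "matrix_inv ?h = matrix_inv A ** C"
      using A C by (intro matrix_inv_unique) (simp add: matrix_mul_assoc)
    have "?h \<in> H"
    proof -
      have "\<mu> (matrix_inv ?h ** X ** ?h) = \<mu> X" if X: "X \<in> D" for X
      proof -
        let ?Y = "C ** X ** matrix_inv C"
        have Y: "?Y \<in> D" using D_conjugate [OF C(1) X] .
        have "matrix_inv ?h ** X ** ?h = matrix_inv A ** ?Y ** A" by (simp add: CA matrix_mul_assoc)
        moreover have "\<mu> (matrix_inv A ** ?Y ** A) = \<nu> w ?Y"
          using wt [OF A(1) Y] \<nu> [OF w Y] A(2) Ob_nz [OF w] by simp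
        moreover have "\<nu> w ?Y = \<nu> b ?Y" using eqw [OF Y] by simp
        moreover have "\<nu> b ?Y = \<mu> (matrix_inv C ** ?Y ** C)"
          using wt [OF C(1) Y] \<nu> [of b, OF _ Y] b Bs(1) C(2) Ob_nz [of b] by auto
        moreover have "matrix_inv C ** ?Y ** C = X" using C(1) by (simp add: matrix_mul_assoc)
        ultimately show ?thesis by simp
      qed
      then show ?thesis using A C by (simp add: H_def)
    qed
    have "w = C *v (?h *v v)" using A C by (simp add: matrix_vector_mul_assoc matrix_mul_assoc)
    also have "\<dots> = l ?h *s b" using l [OF \<open>?h \<in> H\<close>] C by (simp add: vec.scale)
    finally have "w = l ?h *s b" .
    then show ?thesis using l_sign [OF \<open>?h \<in> H\<close>] b(1) by auto
  qed
  have "card Bs = vec.dim (UNIV :: (complex ^ 'n) set)"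
    using vec.dim_eq_card_independent [OF Bs(2)] vec.dim_span [of Bs] by (simp only: spanB)
  then have "card (UNIV :: 'n set) = card Bs" by (simp add: card_cart_basis)
  then obtain b where b: "bij_betw b (UNIV :: 'n set) Bs"
    using finB finite_same_card_bij [of "UNIV :: 'n set" Bs] by auto
  have b_Bs: "b j \<in> Bs" for j using b by (auto simp: bij_betw_def)
  show thesis
  proof (rule that [of b])
    show "vec.span (range b) = UNIV" using b spanB by (simp add: bij_betw_def)
    show "inj b" using b by (simp add: bij_betw_def)
    show "b j \<noteq> - b k" for j k
    proof
      assume eq: "b j = - b k"
      show False
      proof (cases "b j = b k")
        case True
        then have "b k + b k = 0" using eq by (simp add: eq_neg_iff_add_eq_0)
        then have "2 *\<^sub>R b k = 0" by (simp only: scaleR_2)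
        then have "b k = 0" by simp
        then show False using Ob_nz b_Bs Bs(1) by blast
      next
        case False
        then have "b k \<in> vec.span (Bs - {b j})" using b_Bs [of k] by (intro vec.span_base) auto
        then have "b j \<in> vec.span (Bs - {b j})" unfolding eq by (rule vec.span_neg)
        then show False using Bs(2) b_Bs [of j] by (auto simp: vec.dependent_def)
      qed
    qed
    show "\<exists>k. A *v b j = b k \<or> A *v b j = - b k" if A: "A \<in> G" for A j
    proof -
      obtain C where "C \<in> G" "b j = C *v v" using b_Bs Bs(1) by (auto simp: Ob_def)
      then have "A *v b j \<in> Ob" using A by (auto simp: Ob_def matrix_vector_mul_assoc)
      then obtain x where "x \<in> Bs" "A *v b j = x \<or> A *v b j = - x" using rep by blast
      moreover obtain k where "x = b k" using b \<open>x \<in> Bs\<close> by (auto simp: bij_betw_def)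
      ultimately show ?thesis by blast
    qed
    show "X *v b j = b j \<or> X *v b j = - b j" if X: "X \<in> D" for X j
    proof -
      obtain C where C: "C \<in> G" "b j = C *v v" using b_Bs Bs(1) by (auto simp: Ob_def)
      have "X *v b j = \<mu> (matrix_inv C ** X ** C) *s b j" using wt [OF C(1) X] C(2) by simp
      then show ?thesis using \<mu>_sign [OF D_conjugate' [OF C(1) X]] by auto
    qed
  qed
qed

text \<open>In the basis \<open>b\<close> a member \<open>A\<close> of the group has the matrix with entries \<open>s A j\<close> at \<open>(\<sigma> A j, j)\<close>. The
  permutations \<open>\<sigma> A\<close> and \<open>\<sigma> B\<close> commute since \<open>A B\<close> and \<open>B A\<close> differ by a commutator, which only changes signs.\<close>

lemma signed_permutation_form:
  assumes n: "CARD('n) \<ge> 2"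
  obtains P :: "complex ^ 'n ^ 'n"
  where "invertible P" "signed_permutation_group (conjugate_by P G)"
    "commutative_pattern (conjugate_by P G)"
proof -
  obtain b :: "'n \<Rightarrow> complex ^ 'n" where span: "vec.span (range b) = UNIV" and b_inj: "inj b"
    and b_neg: "\<And>j k. b j \<noteq> - b k"
    and b_G: "\<And>A j. A \<in> G \<Longrightarrow> \<exists>k. A *v b j = b k \<or> A *v b j = - b k"
    and b_D: "\<And>X j. X \<in> D \<Longrightarrow> X *v b j = b j \<or> X *v b j = - b j"
    by (rule monomial_basis [OF n]) blast
  define P :: "complex ^ 'n ^ 'n" where "P = (\<chi> i j. b j $ i)"
  have col: "P *v axis j 1 = b j" for j
    by (simp add: matrix_vector_axis column_def P_def vec_eq_iff)
  have "column j P = b j" for j by (simp add: column_def P_def vec_eq_iff)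
  then have "columns P = range b" by (auto simp: columns_def)
  then have "\<exists>B. P ** B = mat 1" using span by (simp add: matrix_right_invertible_span_columns)
  then have P: "invertible P" by (simp add: invertible_right_inverse)
  have Pb: "matrix_inv P *v b j = axis j 1" for j
    by (simp add: col [symmetric] matrix_vector_mul_assoc matrix_inv_mult [OF P])
  have uniq: "k = l" if "c *s b k = d *s b l" "c = 1 \<or> c = -1" "d = 1 \<or> d = -1" for c d k l
  proof -
    have "b k = (c * c) *s b k" using that(2) by auto
    also have "\<dots> = c *s (d *s b l)" by (simp only: vec.scale_scale [symmetric] that(1))
    finally have "b k = b l \<or> b k = - b l" using that(2,3) by auto
    then show ?thesis using b_neg b_inj by (auto simp: inj_eq)
  qed
  have "\<exists>k c. (c = 1 \<or> c = -1) \<and> A *v b j = c *s b k" if A: "A \<in> G" for A j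
  proof -
    obtain k where "A *v b j = 1 *s b k \<or> A *v b j = (-1) *s b k" using b_G [OF A, of j] by auto
    then show ?thesis by blast
  qed
  then obtain \<sigma> s where s: "\<And>A j. A \<in> G \<Longrightarrow> s A j = 1 \<or> s A j = -1"
    and \<sigma>: "\<And>A j. A \<in> G \<Longrightarrow> A *v b j = s A j *s b (\<sigma> A j)"
    by metis
  have \<sigma>_inj: "inj (\<sigma> A)" if A: "A \<in> G" for A
  proof (rule injI)
    fix j k assume eq: "\<sigma> A j = \<sigma> A k"
    have "A *v (s A k *s b j) = A *v (s A j *s b k)"
      using \<sigma> [OF A, of j] \<sigma> [OF A, of k] eq by (simp add: vec.scale mult.commute)
    then have "s A k *s b j = s A j *s b k" using A by (metis inv_vec(2))
    then show "j = k" by (rule uniq [OF _ s [OF A] s [OF A]])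
  qed
  have \<sigma>_ex1: "\<exists>!j. i = \<sigma> A j" if A: "A \<in> G" for A i
  proof -
    have "surj (\<sigma> A)" using \<sigma>_inj [OF A] by (simp add: finite_UNIV_inj_surj)
    then show ?thesis using \<sigma>_inj [OF A] by (metis injD surjD)
  qed
  define M where "M A = matrix_inv P ** A ** P" for A
  have M: "M A $ i $ j = (if i = \<sigma> A j then s A j else 0)" if A: "A \<in> G" for A i j
  proof -
    have "M A *v axis j 1 = s A j *s axis (\<sigma> A j) 1"
      by (simp add: M_def matrix_vector_mul_assoc [symmetric] col \<sigma> [OF A] vec.scale Pb)
    then have "(M A *v axis j 1) $ i = (if i = \<sigma> A j then s A j else 0)"
      by (simp add: axis_def)
    then show ?thesis by (simp add: matrix_vector_axis column_def)
  qed
  have s_nz: "s A j \<noteq> 0" if "A \<in> G" for A j using s [OF that, of j] by auto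
  have sp: "signed_permutation (M A)" if A: "A \<in> G" for A
    unfolding signed_permutation_def
  proof (intro conjI allI)
    show "\<exists>!j. M A $ i $ j \<noteq> 0" for i
      using \<sigma>_ex1 [OF A] s_nz [OF A] by (simp add: M [OF A])
    show "\<exists>!i. M A $ i $ j \<noteq> 0" for j
      using s_nz [OF A] by (simp add: M [OF A])
    show "M A $ i $ j \<noteq> 0 \<longrightarrow> M A $ i $ j \<in> {1, -1}" for i j
      using s [OF A] by (simp add: M [OF A])
  qed
  have \<sigma>_comm: "\<sigma> A (\<sigma> B j) = \<sigma> B (\<sigma> A j)" if A: "A \<in> G" and B: "B \<in> G" for A B j
  proof -
    let ?K = "A ** B ** matrix_inv A ** matrix_inv B"
    have K: "?K \<in> D" using A B by (rule commutator_in_D)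
    have AB: "?K ** (B ** A) = A ** B" using A B by (simp add: matrix_mul_assoc)
    have "A *v (B *v b j) = ?K *v (B *v (A *v b j))"
      by (simp only: matrix_vector_mul_assoc AB matrix_mul_assoc [symmetric])
        (simp only: matrix_mul_assoc AB [unfolded matrix_mul_assoc])
    moreover have "A *v (B *v b j) = (s B j * s A (\<sigma> B j)) *s b (\<sigma> A (\<sigma> B j))"
      by (simp add: \<sigma> [OF A] \<sigma> [OF B] vec.scale)
    moreover have "B *v (A *v b j) = (s A j * s B (\<sigma> A j)) *s b (\<sigma> B (\<sigma> A j))"
      by (simp add: \<sigma> [OF A] \<sigma> [OF B] vec.scale)
    moreover obtain e where e: "e = 1 \<or> e = -1"
      "?K *v b (\<sigma> B (\<sigma> A j)) = e *s b (\<sigma> B (\<sigma> A j))"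
    proof -
      have "?K *v b (\<sigma> B (\<sigma> A j)) = 1 *s b (\<sigma> B (\<sigma> A j))
          \<or> ?K *v b (\<sigma> B (\<sigma> A j)) = (-1) *s b (\<sigma> B (\<sigma> A j))"
        using b_D [OF K] by simp
      then show ?thesis using that by blast
    qed
    ultimately have "(s B j * s A (\<sigma> B j)) *s b (\<sigma> A (\<sigma> B j))
        = (s A j * s B (\<sigma> A j) * e) *s b (\<sigma> B (\<sigma> A j))"
      by (simp add: vec.scale)
    then show ?thesis
      by (rule uniq) (use s [OF A, of "\<sigma> B j"] s [OF B, of j] s [OF A, of j] s [OF B, of "\<sigma> A j"] e(1)
          in auto)
  qed
  have pat: "pattern (M A) ** pattern (M B) = (\<chi> i j. if i = \<sigma> A (\<sigma> B j) then 1 else 0)"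
    if A: "A \<in> G" and B: "B \<in> G" for A B
  proof -
    have p: "pattern (M X) $ i $ j = (if i = \<sigma> X j then 1 else 0)" if "X \<in> G" for X i j
      using s_nz [OF that] by (simp add: pattern_def M [OF that])
    have "(pattern (M A) ** pattern (M B)) $ i $ j = (if i = \<sigma> A (\<sigma> B j) then 1 else 0)" for i j
    proof -
      have "(pattern (M A) ** pattern (M B)) $ i $ j
          = (\<Sum>k\<in>UNIV. pattern (M A) $ i $ k * pattern (M B) $ k $ j)"
        by (simp add: matrix_matrix_mult_def)
      also have "\<dots> = (\<Sum>k\<in>UNIV. if k = \<sigma> B j then (if i = \<sigma> A k then 1 else 0) else 0)"
        by (intro sum.cong) (auto simp: p [OF A] p [OF B])
      finally show ?thesis by simp
    qed
    then show ?thesis by (simp add: vec_eq_iff)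
  qed
  have conj: "conjugate_by P G = M ` G" by (simp add: conjugate_by_def M_def [abs_def])
  have "signed_permutation_group (conjugate_by P G)"
    using matrix_group_conjugate [OF grp P] sp by (auto simp: signed_permutation_group_def conj)
  moreover have "commutative_pattern (conjugate_by P G)"
    unfolding commutative_pattern_def pattern_group_def conj by (auto simp: pat \<sigma>_comm)
  ultimately show thesis using that P by blast
qed

end

lemma realizable_if_signed_permutation_group:
  assumes "invertible P" "signed_permutation_group (conjugate_by P G)"
  shows "realizable G"
proof -
  have "real_entries A" if "A \<in> conjugate_by P G" for A
    unfolding real_entries_def
  proof (intro allI)
    fix i j
    have "A $ i $ j = 0 \<or> A $ i $ j \<in> {1, -1}"
      using assms(2) that unfolding signed_permutation_group_def signed_permutation_def by blast
    then show "A $ i $ j \<in> \<real>" by auto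
  qed
  then show ?thesis using assms unfolding realizable_def signed_permutation_group_def by blast
qed

theorem corollary4p2:
  fixes G :: "(complex ^ 'n ^ 'n) set"
  assumes "CARD('n) \<ge> 2"
    and "matrix_group G"
    and "compact G"
    and "irreducible_matrices G"
    and "\<forall>A\<in>G. \<forall>B\<in>G. spectrum (ring_commutator A B) \<subseteq> \<real>"
  shows "(\<exists>X :: complex ^ 'n ^ 'n. invertible X \<and>
            signed_permutation_group (conjugate_by X G) \<and>
            commutative_pattern (conjugate_by X G)) \<and>
         realizable G"
proof -
  interpret irreducible_commutator_group G
    using assms by unfold_locales
  obtain P where "invertible P" "signed_permutation_group (conjugate_by P G)"
    "commutative_pattern (conjugate_by P G)"
    by (rule signed_permutation_form [OF assms(1)])
  then show ?thesis using realizable_if_signed_permutation_group by blast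
qed

end
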